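(* For every $k,d\in\mathbb N$, $$\max\Bigl\{\|p^{(k)}\|_{\mathbb R_+}\ :\ \mathbf h\in\Delta_d,\ p\in\mathcal P_{\mathbf h},\ \|p\|_{\mathbb R_+}\le1\Bigr\}\ \le\ \sum_{j=0}^{k}\frac{8^j\binom{d-1}{j}\binom{k}{j}}{\binom{2j}{j}},$$ where terms with $j\ge d$ are zero. The maximum on the left equals $M_{k,d}$ and is attained at $p=S_d$, and the inequality is asymptotically tight: for fixed $k$, the ratio of the left-hand side to the right-hand side tends to $1$ as $d\to\infty$.
   Context: Let $\mathbb R_+=[0,\infty)$ and $\|f\|_{\mathbb R_+}=\sup_{t\ge 0}|f(t)|$. For a vector $\mathbf h=(h_1,\dots,h_d)$ with $0<h_1\le\cdots\le h_d$, let $\mathcal P_{\mathbf h}$ be the $d$-dimensional space of real functions on $\mathbb R_+$ spanned by the following system: each distinct value $\eta$ occurring exactly $m$ times among $h_1,\dots,h_d$ contributes the $m$ functions $e^{-\eta t}, te^{-\eta t},\dots,t^{m-1}e^{-\eta t}$. For $k\in\mathbb N$, $M_k(\mathbf h)=\max\{\|p^{(k)}\|_{\mathbb R_+}: p\in\mathcal P_{\mathbf h},\ \|p\|_{\mathbb R_+}\le 1\}$. Let $\Delta_d=\{\mathbf h\in\mathbb R^d: 0<h_1\le\cdots\le h_d\le 1\}$, $\mathbf e=(1,\dots,1)\in\mathbb R^d$, and $M_{k,d}=M_k(\mathbf e)$. The $\mathbf h$-Chebyshev polynomial $T_{\mathbf h}$ is the unique $T\in\mathcal P_{\mathbf h}$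 with $\|T\|_{\mathbb R_+}=1$ for which there exist points $0=\nu_1<\nu_2<\cdots<\nu_d$ with $T(\nu_j)=(-1)^j$ for $j=1,\dots,d$. Set $S_d=T_{\mathbf e}$. Binomial coefficients satisfy $\binom{n}{0}=1$ for $n\ge 0$. *)

theory Defs
  imports "HOL-Analysis.Analysis"
begin

definition supRp :: "(real \<Rightarrow> real) \<Rightarrow> real" where
  "supRp f = (SUP t\<in>{0..}. \<bar>f t\<bar>)"

text \<open>The exponent vector h = (h_1,...,h_d) is a list of length d (0-indexed).
  The i-th basis function is t^m e^{-h_i t}, where m is the number of earlier
  indices j < i with h_j = h_i; for sorted h this is exactly the system
  e^{-\<eta> t}, t e^{-\<eta> t}, ..., t^{m-1} e^{-\<eta> t} for each distinct value \<eta>.\<close>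
definition mult_idx :: "real list \<Rightarrow> nat \<Rightarrow> nat" where
  "mult_idx h i = card {j. j < i \<and> h ! j = h ! i}"

definition Pspace :: "real list \<Rightarrow> (real \<Rightarrow> real) set" where
  "Pspace h = {p. \<exists>c :: nat \<Rightarrow> real.
      p = (\<lambda>t. \<Sum>i<length h. c i * t ^ mult_idx h i * exp (- (h ! i) * t))}"

definition Delta :: "nat \<Rightarrow> real list set" where
  "Delta d = {h. length h = d \<and> sorted h \<and> (\<forall>x\<in>set h. 0 < x \<and> x \<le> 1)}"

definition Mk :: "nat \<Rightarrow> real list \<Rightarrow> real" where
  "Mk k h = Sup {supRp ((deriv ^^ k) p) | p. p \<in> Pspace h \<and> supRp p \<le> 1}"

definition Mkd :: "nat \<Rightarrow> nat \<Rightarrow> real" where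
  "Mkd k d = Mk k (replicate d 1)"

text \<open>h-Chebyshev polynomial; the points \<nu>_1 < ... < \<nu>_d of the paper are
  \<nu> 0 < ... < \<nu> (d-1) here, so T(\<nu> j) = (-1)^(j+1).\<close>
definition cheb :: "real list \<Rightarrow> (real \<Rightarrow> real)" where
  "cheb h = (THE T. T \<in> Pspace h \<and> supRp T = 1 \<and>
     (\<exists>\<nu> :: nat \<Rightarrow> real. \<nu> 0 = 0 \<and>
        (\<forall>i j. i < j \<and> j < length h \<longrightarrow> \<nu> i < \<nu> j) \<and>
        (\<forall>j < length h. T (\<nu> j) = (-1) ^ (j + 1))))"

definition Sd :: "nat \<Rightarrow> (real \<Rightarrow> real)" where
  "Sd d = cheb (replicate d 1)"

definition bound :: "nat \<Rightarrow> nat \<Rightarrow> real" where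
  "bound k d = (\<Sum>j=0..k. 8 ^ j * real ((d - 1) choose j) * real (k choose j)
                            / real ((2 * j) choose j))"

end

theory Submission
  imports Defs
begin

text \<open>A shift of the argument reduces the sup norm of the derivative to its absolute value at 0.
  There the bound \<open>\<bar>p\<bar> \<le> 1\<close> is only used at the alternation points \<open>\<nu>\<close> of the Chebyshev polynomial
  for equal exponents: the extremal \<open>p\<close> takes the values \<open>(-1)\<^sup>j\<close> at these points, and by counting
  zeros with Rolle's theorem the derivative at 0 of this interpolant grows whenever a single exponent
  is increased to 1. The explicit bound comes from comparing with the function
  \<open>H\<^sub>2\<^sub>n(\<surd>(2 t)) exp (- t) / H\<^sub>2\<^sub>n(0)\<close>, \<open>n = d - 1\<close>, whose local extrema, by Sonin's argument, are at least 1
  in absolute value. The same function with its polynomial factor evaluated at \<open>c t\<close>, \<open>c < 1\<close>, has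
  norm 1 for large \<open>n\<close> and loses at most a factor \<open>c\<^sup>k\<close>, which gives the asymptotics.\<close>

section \<open>Spaces of exponential sums\<close>

text \<open>In \<open>Pspace\<close> the powers of t depend on coincidences among the exponents, so
  changing a single exponent disturbs the whole basis. The solution spaces \<open>exp_space\<close>
  of (D + h_1) ... (D + h_d) f = 0 treat all multiplicities alike: exponents can be reordered, one
  of them can be exchanged, and each factor D + h costs at most one zero by Rolle's theorem. With
  positive exponents the members vanish at infinity, so Rolle's theorem for D itself loses no zero;
  this fixes the signs of all derivatives at 0 of a member with the maximal number of positive
  zeros. \<open>Sd\<close> is a definite description, so existence and uniqueness of the Chebyshev
  polynomial have to be established. Existence comes from minimizing |q(-1)| over the polynomials q
  for which q exp(- t) alternates with modulus at least 1: this one number bounds all coefficients,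
  which makes the minimization compact. The right-hand side is exactly the absolute value of the
  k-th derivative of \<open>hfun n\<close> at 0, so all the loss lies in the comparison with that
  function.\<close>

fun exp_space :: "real list \<Rightarrow> (real \<Rightarrow> real) set" where
  "exp_space [] = {\<lambda>t. 0}"
| "exp_space (h # hs) =
     {f. (\<forall>t. f differentiable at t) \<and> (\<lambda>t. deriv f t + h * f t) \<in> exp_space hs}"

declare exp_space.simps(2) [simp del]

lemma exp_space_differentiable: "f \<in> exp_space hs \<Longrightarrow> f differentiable at t"
  by (cases hs) (auto simp: exp_space.simps)

lemma exp_space_DERIV:
  "f \<in> exp_space hs \<Longrightarrow> (f has_real_derivative deriv f t) (at t)"
  using exp_space_differentiable DERIV_deriv_iff_real_differentiable by blast

lemma exp_space_isCont: "f \<in> exp_space hs \<Longrightarrow> isCont f t"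
  using exp_space_DERIV DERIV_isCont by blast

lemma exp_space_continuous_on: "f \<in> exp_space hs \<Longrightarrow> continuous_on S f"
  by (meson continuous_at_imp_continuous_on exp_space_isCont)

lemma exp_space_ConsI:
  assumes "\<And>t. (f has_real_derivative f' t) (at t)" "(\<lambda>t. f' t + h * f t) \<in> exp_space hs"
  shows "f \<in> exp_space (h # hs)"
proof -
  have "deriv f t = f' t" for t using assms(1) DERIV_imp_deriv by blast
  moreover have "f differentiable at t" for t
    using assms(1) real_differentiable_def by blast
  ultimately show ?thesis using assms(2) by (simp add: exp_space.simps)
qed

lemma exp_space_ConsD:
  "f \<in> exp_space (h # hs) \<Longrightarrow> (\<lambda>t. deriv f t + h * f t) \<in> exp_space hs"
  by (simp add: exp_space.simps)

lemma zero_in_exp_space: "(\<lambda>t. 0) \<in> exp_space hs"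
  by (induction hs) (auto intro!: exp_space_ConsI[where f' = "\<lambda>t. 0"])

lemma exp_space_linear:
  "f \<in> exp_space hs \<Longrightarrow> g \<in> exp_space hs \<Longrightarrow> (\<lambda>t. a * f t + b * g t) \<in> exp_space hs"
proof (induction hs arbitrary: f g)
  case (Cons h hs)
  note f = exp_space_DERIV[OF Cons.prems(1)] and g = exp_space_DERIV[OF Cons.prems(2)]
  have "(\<lambda>t. a * (deriv f t + h * f t) + b * (deriv g t + h * g t)) \<in> exp_space hs"
    by (intro Cons.IH exp_space_ConsD Cons.prems)
  then have "(\<lambda>t. (a * deriv f t + b * deriv g t) + h * (a * f t + b * g t)) \<in> exp_space hs"
    by (simp add: algebra_simps)
  then show ?case
    by (rule exp_space_ConsI[rotated]) (auto intro!: derivative_eq_intros f g)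
qed auto

lemma exp_space_diff:
  "f \<in> exp_space hs \<Longrightarrow> g \<in> exp_space hs \<Longrightarrow> (\<lambda>t. f t - g t) \<in> exp_space hs"
  using exp_space_linear[of f hs g 1 "-1"] by simp

lemma exp_space_add:
  "f \<in> exp_space hs \<Longrightarrow> g \<in> exp_space hs \<Longrightarrow> (\<lambda>t. f t + g t) \<in> exp_space hs"
  using exp_space_linear[of f hs g 1 1] by simp

lemma exp_space_scale: "f \<in> exp_space hs \<Longrightarrow> (\<lambda>t. c * f t) \<in> exp_space hs"
  using exp_space_linear[of f hs f c 0] by simp

lemma exp_space_sum:
  "(\<And>i. i \<in> I \<Longrightarrow> f i \<in> exp_space hs) \<Longrightarrow> (\<lambda>t. \<Sum>i\<in>I. f i t) \<in> exp_space hs"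
  by (induction I rule: infinite_finite_induct) (auto intro: zero_in_exp_space exp_space_add)

text \<open>The definition asks for one derivative only; smoothness is bootstrapped here. With g =
  (D + h) f, the function f' = g - h f is differentiable and (D + h) f' = g'.\<close>

lemma exp_space_deriv: "f \<in> exp_space hs \<Longrightarrow> deriv f \<in> exp_space hs"
proof (induction hs arbitrary: f)
  case (Cons h hs)
  define g where "g = (\<lambda>t. deriv f t + h * f t)"
  have g: "g \<in> exp_space hs" unfolding g_def by (rule exp_space_ConsD[OF Cons.prems])
  have "(g has_real_derivative deriv g t) (at t)" for t by (rule exp_space_DERIV[OF g])
  moreover have "deriv f = (\<lambda>t. g t - h * f t)" by (auto simp: g_def)
  moreover have "((\<lambda>t. g t - h * f t) has_real_derivative deriv g t - h * deriv f t) (at t)" for t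
    by (auto intro!: derivative_eq_intros exp_space_DERIV[OF g] exp_space_DERIV[OF Cons.prems])
  ultimately have "(deriv f has_real_derivative deriv g t - h * deriv f t) (at t)" for t by simp
  moreover have "(\<lambda>t. deriv g t - h * deriv f t + h * deriv f t) \<in> exp_space hs"
    using Cons.IH[OF g] by simp
  ultimately show ?case by (rule exp_space_ConsI)
qed auto

lemma exp_space_iter_deriv: "f \<in> exp_space hs \<Longrightarrow> (deriv ^^ k) f \<in> exp_space hs"
  by (induction k) (auto intro: exp_space_deriv)

lemma deriv_linear_exp_space:
  assumes "f \<in> exp_space hs" "g \<in> exp_space gs"
  shows "deriv (\<lambda>t. a * f t + b * g t) = (\<lambda>t. a * deriv f t + b * deriv g t)"
  by (intro ext DERIV_imp_deriv)
     (auto intro!: derivative_eq_intros exp_space_DERIV[OF assms(1)] exp_space_DERIV[OF assms(2)])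

lemma iter_deriv_linear_exp_space:
  "f \<in> exp_space hs \<Longrightarrow> g \<in> exp_space gs \<Longrightarrow>
     (deriv ^^ k) (\<lambda>t. a * f t + b * g t) = (\<lambda>t. a * (deriv ^^ k) f t + b * (deriv ^^ k) g t)"
  by (induction k) (auto intro!: deriv_linear_exp_space exp_space_iter_deriv)

lemma exp_space_subset_Cons: "exp_space hs \<subseteq> exp_space (h # hs)"
  by (auto intro!: exp_space_ConsI[OF exp_space_DERIV] exp_space_add exp_space_deriv exp_space_scale)

lemma exp_space_subset_append: "exp_space hs \<subseteq> exp_space (gs @ hs)"
  by (induction gs) (use exp_space_subset_Cons in auto)

lemma exp_space_Cons_mono:
  "exp_space hs \<subseteq> exp_space gs \<Longrightarrow> exp_space (h # hs) \<subseteq> exp_space (h # gs)"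
  by (auto simp: exp_space.simps)

text \<open>Commutation of D + a and D + b: with g = (D + a) f one has (D + b) f = g + (b - a) f,
  and D + a maps this to (D + b) g.\<close>

lemma exp_space_swap_subset: "exp_space (a # b # hs) \<subseteq> exp_space (b # a # hs)"
proof
  fix f assume f: "f \<in> exp_space (a # b # hs)"
  define g where "g = (\<lambda>t. deriv f t + a * f t)"
  have g: "g \<in> exp_space (b # hs)" unfolding g_def by (rule exp_space_ConsD[OF f])
  have "((\<lambda>t. g t + (b - a) * f t) has_real_derivative deriv g t + (b - a) * deriv f t) (at t)" for t
    by (auto intro!: derivative_eq_intros exp_space_DERIV[OF f] exp_space_DERIV[OF g])
  moreover have "(\<lambda>t. deriv g t + (b - a) * deriv f t + a * (g t + (b - a) * f t)) \<in> exp_space hs"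
    using exp_space_ConsD[OF g] by (simp add: g_def algebra_simps)
  ultimately have "(\<lambda>t. g t + (b - a) * f t) \<in> exp_space (a # hs)" by (rule exp_space_ConsI)
  then have "(\<lambda>t. deriv f t + b * f t) \<in> exp_space (a # hs)" by (simp add: g_def algebra_simps)
  then show "f \<in> exp_space (b # a # hs)"
    by (rule exp_space_ConsI[OF exp_space_DERIV[OF f]])
qed

lemma exp_space_swap: "exp_space (a # b # hs) = exp_space (b # a # hs)"
  using exp_space_swap_subset by blast

lemma exp_space_move: "exp_space (xs @ h # ys) = exp_space (h # xs @ ys)"
proof (induction xs)
  case (Cons x xs)
  have "exp_space ((x # xs) @ h # ys) = exp_space (x # h # xs @ ys)"
    using Cons exp_space_Cons_mono[of "xs @ h # ys" "h # xs @ ys" x]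
      exp_space_Cons_mono[of "h # xs @ ys" "xs @ h # ys" x] by simp
  then show ?case using exp_space_swap[of x h "xs @ ys"] by simp
qed simp

lemma exp_space_shift: "f \<in> exp_space hs \<Longrightarrow> (\<lambda>t. f (t + s)) \<in> exp_space hs"
proof (induction hs arbitrary: f)
  case (Cons h hs)
  have "((\<lambda>t. f (t + s)) has_real_derivative deriv f (t + s)) (at t)" for t
    using exp_space_DERIV[OF Cons.prems, of "t + s"] DERIV_shift by blast
  then show ?case
    by (rule exp_space_ConsI) (use Cons.IH[OF exp_space_ConsD[OF Cons.prems]] in simp)
qed auto

lemma deriv_shift: "deriv (\<lambda>t. f (t + s)) = (\<lambda>t. deriv f (t + s))" for f :: "real \<Rightarrow> real"
  by (intro ext) (simp add: deriv_def DERIV_shift[symmetric])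

lemma iter_deriv_shift:
  "(deriv ^^ k) (\<lambda>t. f (t + s)) = (\<lambda>t. (deriv ^^ k) f (t + s))" for f :: "real \<Rightarrow> real"
  by (induction k) (auto simp: deriv_shift)

text \<open>D + x lowers the power of t by one and annihilates exp(- x t), so every occurrence of x
  in \<open>hs\<close> admits one more power.\<close>

lemma power_times_exp_in_exp_space:
  "m < length (filter ((=) x) hs) \<Longrightarrow> (\<lambda>t. t ^ m * exp (- x * t)) \<in> exp_space hs"
proof (induction hs arbitrary: m)
  case (Cons h hs)
  show ?case
  proof (cases "x = h")
    case True
    have "(\<lambda>t. real m * (t ^ (m - 1) * exp (- x * t))) \<in> exp_space hs"
    proof (cases m)
      case 0 then show ?thesis by (simp add: zero_in_exp_space)
    next
      case (Suc l) then show ?thesis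
        using Cons True by (intro exp_space_scale Cons.IH) auto
    qed
    moreover have "((\<lambda>t. t ^ m * exp (- x * t)) has_real_derivative
       real m * (t ^ (m - 1) * exp (- x * t)) - x * (t ^ m * exp (- x * t))) (at t)" for t
      by (auto intro!: derivative_eq_intros simp: algebra_simps)
    ultimately show ?thesis by (intro exp_space_ConsI) (auto simp: True)
  next
    case False
    then show ?thesis using Cons exp_space_subset_Cons[of hs h] by auto
  qed
qed simp

lemma Pspace_subset_exp_space: "Pspace hs \<subseteq> exp_space hs"
proof
  fix p assume "p \<in> Pspace hs"
  then obtain c where p: "p = (\<lambda>t. \<Sum>i<length hs. c i * t ^ mult_idx hs i * exp (- (hs ! i) * t))"
    by (auto simp: Pspace_def)
  \<comment> \<open>Strict, because position i itself is counted on the right but not among the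
    earlier positions.\<close>
  have "mult_idx hs i < length (filter ((=) (hs ! i)) hs)" if "i < length hs" for i
    unfolding mult_idx_def length_filter_conv_card
    by (rule psubset_card_mono) (use that in auto)
  then show "p \<in> exp_space hs" unfolding p mult.assoc
    by (intro exp_space_sum exp_space_scale power_times_exp_in_exp_space) auto
qed

text \<open>L'Hospital's rule for exp(h t) f / exp(h t): the quotient of the derivatives is g / h
  with g = (D + h) f, which tends to 0 by induction.\<close>

lemma exp_space_tendsto_0:
  "f \<in> exp_space hs \<Longrightarrow> \<forall>h\<in>set hs. 0 < h \<Longrightarrow> (f \<longlongrightarrow> 0) at_top"
proof (induction hs arbitrary: f)
  case (Cons h hs)
  define g where "g = (\<lambda>t. deriv f t + h * f t)"
  have "h > 0" using Cons.prems by simp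
  have "(g \<longlongrightarrow> 0) at_top"
    unfolding g_def by (rule Cons.IH[OF exp_space_ConsD]) (use Cons.prems in auto)
  then have "((\<lambda>t. g t / h) \<longlongrightarrow> 0) at_top"
    using tendsto_divide[OF _ tendsto_const[of h]] \<open>h > 0\<close> by fastforce
  then have "((\<lambda>t. (exp (h * t) * g t) / (h * exp (h * t))) \<longlongrightarrow> 0) at_top" by simp
  moreover have "((\<lambda>t. exp (h * t) * f t) has_real_derivative exp (h * t) * g t) (at t)" for t
    by (auto intro!: derivative_eq_intros exp_space_DERIV[OF Cons.prems(1)]
        simp: g_def algebra_simps)
  moreover have "((\<lambda>t. exp (h * t)) has_real_derivative h * exp (h * t)) (at t)" for t
    by (auto intro!: derivative_eq_intros)
  moreover have "filterlim (\<lambda>t. exp (h * t)) at_top at_top"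
    using \<open>h > 0\<close> by (intro filterlim_compose[OF exp_at_top]
      filterlim_tendsto_pos_mult_at_top[OF tendsto_const]) (auto simp: filterlim_ident)
  ultimately have "((\<lambda>t. (exp (h * t) * f t) / exp (h * t)) \<longlongrightarrow> 0) at_top"
    using \<open>h > 0\<close> by (intro lhospital_at_top_at_top[where f = "\<lambda>t. exp (h * t) * f t"
          and g = "\<lambda>t. exp (h * t)" and f' = "\<lambda>t. exp (h * t) * g t"
          and g' = "\<lambda>t. h * exp (h * t)"] always_eventually allI) simp_all
  then show ?case by simp
qed auto

section \<open>Rolle's theorem on finite sets and at infinity, and the counting of zeros\<close>

lemma Rolle_finite_set:
  fixes g :: "real \<Rightarrow> real"
  assumes "finite Z" and "\<And>t. (g has_real_derivative g' t) (at t)" and "\<forall>z\<in>Z. g z = 0"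
  obtains Y where "finite Y" "card Y = card Z - 1" "Y \<inter> Z = {}" "\<forall>y\<in>Y. g' y = 0"
    "\<forall>y\<in>Y. (\<exists>z\<in>Z. z < y) \<and> (\<exists>z\<in>Z. y < z)"
proof -
  \<comment> \<open>One point per gap, adding the zeros in increasing order. Disjointness from
    \<open>Z\<close> later makes a double zero count twice; the last clause keeps the new points to
    the right of old zeros.\<close>
  have "\<exists>Y. finite Y \<and> card Y = card Z - 1 \<and> Y \<inter> Z = {} \<and> (\<forall>y\<in>Y. g' y = 0) \<and>
     (\<forall>y\<in>Y. (\<exists>z\<in>Z. z < y) \<and> (\<exists>z\<in>Z. y < z))"
    using assms(1,3)
  proof (induction Z rule: finite_linorder_max_induct)
    case (insert b A)
    then obtain Y where Y: "finite Y" "card Y = card A - 1" "Y \<inter> A = {}" "\<forall>y\<in>Y. g' y = 0"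
      "\<forall>y\<in>Y. (\<exists>z\<in>A. z < y) \<and> (\<exists>z\<in>A. y < z)" by auto
    have bA: "b \<notin> A" using insert.hyps by auto
    show ?case
    proof (cases "A = {}")
      case False
      define a where "a = Max A"
      have aA: "a \<in> A" and a_max: "\<And>z. z \<in> A \<Longrightarrow> z \<le> a"
        using insert.hyps False by (auto simp: a_def)
      have "a < b" using insert.hyps aA by auto
      have "\<exists>y>a. y < b \<and> g' y = 0"
        using MVT2[OF \<open>a < b\<close> assms(2)] aA insert.prems \<open>a < b\<close> by auto
      then obtain y where y: "a < y" "y < b" "g' y = 0" by blast
      have "y \<notin> Y" using Y(5) a_max y by (metis less_le_trans less_asym not_less)
      moreover have "card A \<ge> 1" using False insert.hyps by (simp add: Suc_leI card_gt_0_iff)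
      ultimately show ?thesis
        using Y y bA aA a_max insert.hyps
        by (intro exI[of _ "insert y Y"])
          (auto, (metis less_asym less_le_trans not_less)+)
    qed (use Y bA in \<open>auto intro: exI[of _ "{}"]\<close>)
  qed (auto intro: exI[of _ "{}"])
  then show ?thesis using that by blast
qed

text \<open>Infinity acts as a second zero. Far out at b the modulus is below |g(a + 1)|, so it is
  also taken at some x in [a, a + 1]. Equal values give Rolle on [x, b]; opposite values give a
  further zero c and Rolle on [a, c].\<close>

lemma critical_point_after_zero:
  fixes g :: "real \<Rightarrow> real"
  assumes "\<And>t. (g has_real_derivative g' t) (at t)" "g a = 0" "(g \<longlongrightarrow> 0) at_top"
  obtains c where "c > a" "g' c = 0"
proof -
  have cont: "continuous_on S g" for S
    by (meson assms(1) continuous_at_imp_continuous_on DERIV_isCont)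
  have rolle: "\<exists>c>x. c < y \<and> g' c = 0" if "x < y" "g x = g y" for x y
    using MVT2[OF \<open>x < y\<close> assms(1)] that by auto
  show ?thesis
  proof (cases "g (a + 1) = 0")
    case True
    then show ?thesis using rolle[of a "a + 1"] assms(2) that by auto
  next
    case False
    have "\<forall>\<^sub>F t in at_top. \<bar>g t\<bar> < \<bar>g (a + 1)\<bar> \<and> t > a + 1"
      using tendstoD[OF assms(3), of "\<bar>g (a + 1)\<bar>"] False by (simp add: eventually_conj_iff)
    then obtain b where b: "\<bar>g b\<bar> < \<bar>g (a + 1)\<bar>" "b > a + 1"
      using eventually_happens by force
    have "\<exists>x. a \<le> x \<and> x \<le> a + 1 \<and> \<bar>g x\<bar> = \<bar>g b\<bar>"
      using b assms(2) by (intro IVT' continuous_intros cont) auto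
    then obtain x where x: "a \<le> x" "x \<le> a + 1" "\<bar>g x\<bar> = \<bar>g b\<bar>" by blast
    show ?thesis
    proof (cases "g x = g b")
      case True
      then show ?thesis using rolle[of x b] x b that by force
    next
      case False
      then have gx: "g x = - g b" using x by (simp add: abs_eq_iff)
      have "\<exists>c\<ge>x. c \<le> b \<and> g c = 0"
      proof (cases "g x \<le> 0")
        case True then show ?thesis using gx x b by (intro IVT' cont) auto
      next
        case False then show ?thesis using gx x b by (intro IVT2' cont) auto
      qed
      then obtain c where c: "c \<ge> x" "g c = 0" by blast
      have "c \<noteq> a" using False gx c x assms(2) by auto
      then show ?thesis using rolle[of a c] c x assms(2) that by force
    qed
  qed
qed

text \<open>The critical point beyond the largest zero makes up for the one that Rolle's theorem
  loses.\<close>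

lemma Rolle_at_infinity_finite_set:
  fixes g :: "real \<Rightarrow> real"
  assumes "finite Z" and "\<And>t. (g has_real_derivative g' t) (at t)" and "\<forall>z\<in>Z. g z = 0"
    and "(g \<longlongrightarrow> 0) at_top"
  obtains Y where "finite Y" "card Y = card Z" "\<forall>y\<in>Y. g' y = 0" "\<forall>y\<in>Y. \<exists>z\<in>Z. z < y"
proof (cases "Z = {}")
  case False
  obtain Y where Y: "finite Y" "card Y = card Z - 1" "\<forall>y\<in>Y. g' y = 0"
    "\<forall>y\<in>Y. (\<exists>z\<in>Z. z < y) \<and> (\<exists>z\<in>Z. y < z)"
    using Rolle_finite_set[OF assms(1-3)] by metis
  have M: "Max Z \<in> Z" "\<And>z. z \<in> Z \<Longrightarrow> z \<le> Max Z" using False assms(1) by auto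
  obtain c where c: "c > Max Z" "g' c = 0"
    using critical_point_after_zero[OF assms(2) _ assms(4), of "Max Z"] M(1) assms(3) by blast
  have "c \<notin> Y" using Y(4) M(2) c(1) by (meson less_asym less_le_trans)
  moreover have "card Z \<ge> 1" using False assms(1) by (simp add: Suc_leI card_gt_0_iff)
  ultimately show ?thesis using that[of "insert c Y"] Y c M(1) by auto
qed (use that[of "{}"] in auto)

text \<open>Rolle's theorem for \<open>D + h\<close> is Rolle's theorem for \<open>D\<close> applied to \<open>exp (h t) f t\<close>.\<close>

lemma Rolle_shifted_derivative:
  assumes "finite Z" "f \<in> exp_space hs" "\<forall>z\<in>Z. f z = 0"
  obtains Y where "finite Y" "card Y = card Z - 1" "Y \<inter> Z = {}" "\<forall>y\<in>Y. deriv f y + h * f y = 0"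
proof -
  have "((\<lambda>t. exp (h * t) * f t) has_real_derivative exp (h * t) * (deriv f t + h * f t)) (at t)" for t
    by (auto intro!: derivative_eq_intros exp_space_DERIV[OF assms(2)] simp: algebra_simps)
  from Rolle_finite_set[OF assms(1) this] assms(3) that show ?thesis by auto metis
qed

lemma exp_space_eq_zero_of_deriv:
  assumes "f \<in> exp_space hs" "\<forall>t. deriv f t + h * f t = 0" "f z = 0"
  shows "f t = 0"
proof -
  have "((\<lambda>t. exp (h * t) * f t) has_real_derivative exp (h * t) * (deriv f t + h * f t)) (at t)" for t
    by (auto intro!: derivative_eq_intros exp_space_DERIV[OF assms(1)] simp: algebra_simps)
  then have "exp (h * t) * f t = exp (h * z) * f z"
    using assms(2) by (intro DERIV_isconst_all) simp
  then show ?thesis using assms(3) by simp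
qed

text \<open>The Chebyshev system property. Each D + h removes at most one zero, and once all
  exponents are used up only the zero function is left.\<close>

lemma exp_space_zeros:
  "f \<in> exp_space hs \<Longrightarrow> finite Z \<Longrightarrow> length hs \<le> card Z \<Longrightarrow> \<forall>z\<in>Z. f z = 0 \<Longrightarrow> f t = 0"
proof (induction hs arbitrary: f Z t)
  case (Cons h hs)
  obtain Y where Y: "finite Y" "card Y = card Z - 1" "\<forall>y\<in>Y. deriv f y + h * f y = 0"
    using Rolle_shifted_derivative[OF Cons.prems(2,1,4)] by metis
  have "deriv f t + h * f t = 0" for t
    using Cons.IH[OF exp_space_ConsD[OF Cons.prems(1)] Y(1)] Y Cons.prems by auto
  moreover obtain z where "z \<in> Z" using Cons.prems by fastforce
  ultimately show ?case using exp_space_eq_zero_of_deriv Cons.prems by blast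
qed simp

text \<open>At the double zero (D + h) f vanishes too, and this point is not among those produced by
  Rolle's theorem. The zero lost there is regained, so one distinct zero fewer suffices.\<close>

lemma exp_space_double_zero:
  assumes "f \<in> exp_space hs" "finite Z" "length hs \<le> Suc (card Z)" "\<forall>z\<in>Z. f z = 0"
    "a \<in> Z" "deriv f a = 0"
  shows "f t = 0"
proof (cases hs)
  case (Cons h gs)
  obtain Y where Y: "finite Y" "card Y = card Z - 1" "Y \<inter> Z = {}"
      "\<forall>y\<in>Y. deriv f y + h * f y = 0"
    using Rolle_shifted_derivative[OF assms(2,1,4)] by metis
  have "card (insert a Y) = card Z" "finite (insert a Y)"
    using Y assms(2,5) by (auto simp: card_insert_if disjoint_iff intro!: Suc_pred card_gt_0_iff[THEN iffD2])
  then have "deriv f t + h * f t = 0" for t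
    using Y assms Cons
    by (intro exp_space_zeros[OF exp_space_ConsD, of f h gs "insert a Y"]) auto
  then show ?thesis using exp_space_eq_zero_of_deriv assms by blast
qed (use assms in auto)

text \<open>Replaces an appeal to analyticity: (D + h) f inherits the vanishing of all derivatives
  at a. Serves the uniqueness of the Chebyshev polynomial.\<close>

lemma exp_space_all_derivs_zero:
  "f \<in> exp_space hs \<Longrightarrow> \<forall>k. (deriv ^^ k) f a = 0 \<Longrightarrow> f t = 0"
proof (induction hs arbitrary: f t)
  case (Cons h hs)
  have df: "deriv f \<in> exp_space (h # hs)" by (rule exp_space_deriv[OF Cons.prems(1)])
  have "(deriv ^^ k) (\<lambda>t. deriv f t + h * f t) a = 0" for k
    using iter_deriv_linear_exp_space[OF df Cons.prems(1), of k 1 h] Cons.prems(2)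
    by (simp, metis comp_apply funpow_Suc_right)
  then have "deriv f t + h * f t = 0" for t
    by (intro Cons.IH[OF exp_space_ConsD[OF Cons.prems(1)]]) simp
  moreover have "f a = 0" using Cons.prems(2)[rule_format, of 0] by simp
  ultimately show ?case using exp_space_eq_zero_of_deriv Cons.prems(1) by blast
qed simp

text \<open>Interpolation: the new basis function must be independent of the old space, for otherwise
  that space would contain \<open>exp (- h t)\<close> times polynomials with arbitrarily many zeros.\<close>

lemma polynomial_times_exp_in_exp_space:
  "finite Z \<Longrightarrow> (\<lambda>t. (\<Prod>z\<in>Z. t - z) * exp (- h * t)) \<in> exp_space (replicate (Suc (card Z)) h)"
proof -
  assume "finite Z"
  define q where "q = (\<Prod>z\<in>Z. [:- z, 1:])"
  have deg: "degree q \<le> card Z" unfolding q_def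
    using degree_prod_sum_le[OF \<open>finite Z\<close>, of "\<lambda>z. [:- z, 1:]"] by simp
  have "(\<lambda>t. \<Sum>i\<le>degree q. coeff q i * (t ^ i * exp (- h * t)))
      \<in> exp_space (replicate (Suc (card Z)) h)"
    using deg by (intro exp_space_sum exp_space_scale power_times_exp_in_exp_space)
      (simp del: replicate_Suc)
  moreover have "(\<Sum>i\<le>degree q. coeff q i * (t ^ i * exp (- h * t)))
      = (\<Prod>z\<in>Z. t - z) * exp (- h * t)" for t
    by (subst mult.assoc[symmetric], subst sum_distrib_right[symmetric])
      (simp add: poly_altdef[symmetric] q_def poly_prod)
  ultimately show ?thesis by simp
qed

lemma exp_space_proper_Cons:
  obtains f where "f \<in> exp_space (h # hs)" "f \<notin> exp_space hs"
proof -
  have "exp_space (h # hs) \<noteq> exp_space hs"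
  proof
    assume eq: "exp_space (h # hs) = exp_space hs"
    have rep: "exp_space (replicate n h @ hs) = exp_space hs" for n
    proof (induction n)
      case (Suc n)
      then have "exp_space (replicate (Suc n) h @ hs) = exp_space (h # hs)"
        using exp_space_Cons_mono[of "replicate n h @ hs" hs h]
          exp_space_Cons_mono[of hs "replicate n h @ hs" h] by simp
      then show ?case using eq by simp
    qed simp
    define Z where "Z = real ` {..<length hs}"
    have Z: "finite Z" "card Z = length hs" by (auto simp: Z_def card_image)
    let ?f = "\<lambda>t. (\<Prod>z\<in>Z. t - z) * exp (- h * t)"
    have "?f \<in> exp_space (replicate (Suc (card Z)) h)"
      by (rule polynomial_times_exp_in_exp_space[OF Z(1)])
    also have "\<dots> \<subseteq> exp_space (hs @ replicate (Suc (card Z)) h)"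
      by (rule exp_space_subset_append)
    also have "\<dots> = exp_space (replicate (Suc (card Z)) h @ hs)"
    proof -
      have "exp_space (xs @ replicate n h @ ys) = exp_space (replicate n h @ xs @ ys)" for n xs ys
      proof (induction n arbitrary: ys)
        case (Suc n)
        have "exp_space (xs @ replicate (Suc n) h @ ys) = exp_space (xs @ replicate n h @ h # ys)"
          by (simp add: replicate_app_Cons_same)
        also have "\<dots> = exp_space ((replicate n h @ xs) @ h # ys)" using Suc[of "h # ys"] by simp
        also have "\<dots> = exp_space (h # replicate n h @ xs @ ys)"
          using exp_space_move[of "replicate n h @ xs" h ys] by simp
        finally show ?case by simp
      qed simp
      from this[of hs _ "[]"] show ?thesis by (metis append_Nil2)
    qed
    also have "\<dots> = exp_space hs" by (rule rep)
    \<comment> \<open>The zeros of the product are the \<open>length hs\<close> points of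
      \<open>Z\<close>, too many for a nonzero member of \<open>exp_space hs\<close>; but all of
      them are nonnegative, so -1 is none of them.\<close>
    finally have "?f (-1) = 0"
      using Z by (intro exp_space_zeros[of ?f hs Z]) auto
    then show False using Z by (auto simp: Z_def)
  qed
  then show ?thesis using that exp_space_subset_Cons[of hs h] by blast
qed

text \<open>Newton's scheme: w vanishes at the earlier nodes, and by zero counting not at the last
  one, so a multiple of w corrects the last value without disturbing the others.\<close>

lemma exp_space_interpolation:
  "inj_on \<nu> {..<length hs} \<Longrightarrow> \<exists>f\<in>exp_space hs. \<forall>j<length hs. f (\<nu> j) = y j"
proof (induction hs arbitrary: y)
  case (Cons h hs)
  define n where "n = length hs"
  have inj: "inj_on \<nu> {..<n}" using Cons.prems by (rule inj_on_subset) (auto simp: n_def)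
  obtain \<phi> where \<phi>: "\<phi> \<in> exp_space (h # hs)" "\<phi> \<notin> exp_space hs"
    by (rule exp_space_proper_Cons)
  obtain \<psi> where \<psi>: "\<psi> \<in> exp_space hs" "\<forall>j<n. \<psi> (\<nu> j) = \<phi> (\<nu> j)"
    using Cons.IH[of "\<lambda>j. \<phi> (\<nu> j)"] inj by (auto simp: n_def)
  define w where "w = (\<lambda>t. \<phi> t - \<psi> t)"
  have w: "w \<in> exp_space (h # hs)"
    unfolding w_def using \<phi> \<psi> exp_space_subset_Cons by (intro exp_space_diff) auto
  have "w (\<nu> n) \<noteq> 0"
  proof
    assume 0: "w (\<nu> n) = 0"
    have "w t = 0" for t
    proof (rule exp_space_zeros[OF w])
      show "length (h # hs) \<le> card (\<nu> ` {..n})"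
        using Cons.prems by (simp add: card_image n_def lessThan_Suc_atMost)
      show "\<forall>z\<in>\<nu> ` {..n}. w z = 0"
        using \<psi> 0 by (auto simp: w_def le_less)
    qed simp
    then have "\<phi> = \<psi>" by (auto simp: w_def)
    then show False using \<phi> \<psi> by simp
  qed
  obtain g where g: "g \<in> exp_space hs" "\<forall>j<n. g (\<nu> j) = y j"
    using Cons.IH[of y] inj by (auto simp: n_def)
  define c where "c = (y n - g (\<nu> n)) / w (\<nu> n)"
  show ?case
  proof (rule bexI)
    show "(\<lambda>t. g t + c * w t) \<in> exp_space (h # hs)"
      using g w exp_space_subset_Cons by (intro exp_space_add exp_space_scale) auto
    show "\<forall>j<length (h # hs). g (\<nu> j) + c * w (\<nu> j) = y j"
      using g \<psi> \<open>w (\<nu> n) \<noteq> 0\<close> by (auto simp: less_Suc_eq n_def[symmetric] w_def c_def)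
  qed
qed (use zero_in_exp_space[of "[]"] in auto)

section \<open>Extremal derivatives at 0\<close>

text \<open>The extremal situation: one zero fewer than the length is the most that a nonzero member
  can have, and here they are all strictly positive. Nothing is left for a zero at 0, and the
  property passes to the derivative.\<close>

definition full_zeros :: "real list \<Rightarrow> (real \<Rightarrow> real) \<Rightarrow> bool" where
  "full_zeros hs f \<longleftrightarrow> f \<in> exp_space hs \<and> (\<exists>t. f t \<noteq> 0) \<and> (\<forall>h\<in>set hs. 0 < h) \<and>
     (\<exists>Z. finite Z \<and> Suc (card Z) = length hs \<and> (\<forall>z\<in>Z. 0 < z \<and> f z = 0))"

text \<open>The sign condition says that |f| does not start to decrease at 0. Being smaller at b, it
  is either stationary at 0 or returns to the value \<open>f 0\<close> before b.\<close>

lemma critical_point_before: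
  fixes f :: "real \<Rightarrow> real"
  assumes "\<And>t. (f has_real_derivative f' t) (at t)" "f 0 * f' 0 \<ge> 0" "0 < b" "\<bar>f b\<bar> < \<bar>f 0\<bar>"
  obtains c where "0 \<le> c" "c < b" "f' c = 0"
proof -
  have pos: "\<exists>c\<ge>0. c < b \<and> g' c = 0"
    if g: "\<And>t. (g has_real_derivative g' t) (at t)" and g': "g' 0 \<ge> 0" and g0: "g 0 > 0" "g b < g 0"
    for g g' :: "real \<Rightarrow> real"
  proof (cases "g' 0 = 0")
    case False
    then obtain d where d: "d > 0" "\<And>h. 0 < h \<Longrightarrow> h < d \<Longrightarrow> g 0 < g (0 + h)"
      using DERIV_pos_inc_right[OF g, of 0] g' by force
    define x where "x = min (d / 2) (b / 2)"
    have x: "0 < x" "x < d" "x < b" using d(1) \<open>0 < b\<close> by (auto simp: x_def min_def)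
    have "continuous_on {x..b} g"
      by (meson g continuous_at_imp_continuous_on DERIV_isCont)
    then have "\<exists>y\<ge>x. y \<le> b \<and> g y = g 0"
      using d(2)[of x] x g0 by (intro IVT2') auto
    then obtain y where y: "y \<ge> x" "y \<le> b" "g y = g 0" by blast
    have "0 < y" using y x by simp
    obtain c where "0 < c" "c < y" "g y - g 0 = (y - 0) * g' c"
      using MVT2[OF \<open>0 < y\<close> g] by blast
    then show ?thesis using y \<open>0 < y\<close> by (intro exI[of _ c]) auto
  qed (use \<open>0 < b\<close> in auto)
  show ?thesis
  proof (cases "f 0 > 0")
    case True
    then show ?thesis using pos[of f f', OF assms(1)] assms(2-4) that
      by (auto simp: zero_le_mult_iff abs_less_iff)
  next
    case False
    have "\<exists>c\<ge>0. c < b \<and> - f' c = 0"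
    proof (rule pos)
      show "((\<lambda>t. - f t) has_real_derivative - f' t) (at t)" for t
        by (intro derivative_intros assms(1))
    qed (use False assms in \<open>auto simp: zero_le_mult_iff\<close>)
    then show ?thesis using that by auto
  qed
qed

lemma full_zeros_at_0:
  assumes "full_zeros hs f"
  shows "f 0 \<noteq> 0"
proof
  assume 0: "f 0 = 0"
  obtain Z where Z: "finite Z" "Suc (card Z) = length hs" "\<forall>z\<in>Z. 0 < z \<and> f z = 0"
    using assms by (auto simp: full_zeros_def)
  have "0 \<notin> Z" using Z by auto
  then have "length hs \<le> card (insert 0 Z)" using Z by simp
  then have "f t = 0" for t
    using assms 0 Z by (intro exp_space_zeros[of f hs "insert 0 Z"]) (auto simp: full_zeros_def)
  then show False using assms by (auto simp: full_zeros_def)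
qed

text \<open>Rolle's theorem at infinity gives f' as many zeros as f, all beyond the first zero of f.
  If |f| did not decrease at 0, there would be one more critical point before that zero (or before a
  far point, if f has no zero), which is one too many.\<close>

lemma full_zeros_deriv:
  assumes "full_zeros hs f"
  shows "full_zeros hs (deriv f)" and "f 0 * deriv f 0 < 0"
proof -
  have f: "f \<in> exp_space hs" and pos: "\<forall>h\<in>set hs. 0 < h" using assms by (auto simp: full_zeros_def)
  obtain Z where Z: "finite Z" "Suc (card Z) = length hs" "\<forall>z\<in>Z. 0 < z \<and> f z = 0"
    using assms by (auto simp: full_zeros_def)
  have lim: "(f \<longlongrightarrow> 0) at_top" by (rule exp_space_tendsto_0[OF f pos])
  have f0: "f 0 \<noteq> 0" by (rule full_zeros_at_0[OF assms])
  have nz: "\<exists>t. deriv f t \<noteq> 0"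
  proof (rule ccontr)
    assume "\<not> ?thesis"
    then have "f t = f 0" for t using exp_space_DERIV[OF f] by (intro DERIV_isconst_all) auto
    then have "(f \<longlongrightarrow> f 0) at_top" by (intro tendsto_eventually always_eventually allI)
    then show False using tendsto_unique[OF _ lim] f0 by force
  qed
  obtain Y where Y: "finite Y" "card Y = card Z" "\<forall>y\<in>Y. deriv f y = 0" "\<forall>y\<in>Y. \<exists>z\<in>Z. z < y"
    using Rolle_at_infinity_finite_set[OF Z(1) exp_space_DERIV[OF f] _ lim] Z(3) by blast
  have Y0: "\<forall>y\<in>Y. 0 < y" using Y(4) Z(3) by (meson less_trans)
  show "full_zeros hs (deriv f)"
    unfolding full_zeros_def using exp_space_deriv[OF f] nz pos Y Y0 Z(2) by auto
  show "f 0 * deriv f 0 < 0"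
  proof (rule ccontr)
    assume "\<not> ?thesis"
    then have ge: "f 0 * deriv f 0 \<ge> 0" by simp
    have "\<exists>b>0. \<bar>f b\<bar> < \<bar>f 0\<bar> \<and> (\<forall>z\<in>Z. b \<le> z)"
    proof (cases "Z = {}")
      case True
      have "\<forall>\<^sub>F t in at_top. \<bar>f t\<bar> < \<bar>f 0\<bar> \<and> t > 0"
        using tendstoD[OF lim, of "\<bar>f 0\<bar>"] f0 by (simp add: eventually_conj_iff)
      then show ?thesis using True eventually_happens by force
    next
      case False
      then show ?thesis using Z f0 by (intro exI[of _ "Min Z"]) auto
    qed
    then obtain b where b: "b > 0" "\<bar>f b\<bar> < \<bar>f 0\<bar>" "\<forall>z\<in>Z. b \<le> z" by blast
    obtain c where c: "0 \<le> c" "c < b" "deriv f c = 0"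
      using critical_point_before[OF exp_space_DERIV[OF f] ge b(1,2)] .
    have "c \<notin> Y" using Y(4) b(3) c(2) by force
    then have "length hs \<le> card (insert c Y)" using Y Z by simp
    then have "deriv f t = 0" for t
      using c Y by (intro exp_space_zeros[OF exp_space_deriv[OF f], of "insert c Y"]) auto
    then show False using nz by blast
  qed
qed

text \<open>Each derivative is again of this kind, so consecutive derivatives at 0 have opposite
  signs. In particular none vanishes, which is the contradiction used in
  \<open>alternation_maximizes_deriv\<close>.\<close>

lemma full_zeros_iter_deriv_sign:
  "full_zeros hs f \<Longrightarrow> 0 < (-1) ^ k * (deriv ^^ k) f 0 * f 0"
proof (induction k arbitrary: f)
  case 0
  then show ?case using full_zeros_at_0 by (simp add: zero_less_mult_iff linorder_neq_iff disj_commute)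
next
  case (Suc k)
  have "0 < (-1) ^ k * (deriv ^^ k) (deriv f) 0 * deriv f 0" "f 0 * deriv f 0 < 0"
    using Suc.IH full_zeros_deriv[OF Suc.prems] by auto
  then show ?case
    by (simp add: funpow_Suc_right del: funpow.simps)
      (auto simp: zero_less_mult_iff mult_less_0_iff)
qed

lemma zero_between:
  fixes f :: "real \<Rightarrow> real"
  assumes "a < b" "f a * f b < 0" "continuous_on {a..b} f"
  obtains c where "a < c" "c < b" "f c = 0"
proof -
  have "\<exists>c\<ge>a. c \<le> b \<and> f c = 0"
  proof (cases "f a \<le> 0")
    case True then show ?thesis using assms by (intro IVT') (auto simp: mult_less_0_iff)
  next
    case False then show ?thesis using assms by (intro IVT2') (auto simp: mult_less_0_iff)
  qed
  then obtain c where c: "c \<ge> a" "c \<le> b" "f c = 0" by blast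
  moreover have "c \<noteq> a" "c \<noteq> b" using assms(2) c(3) by auto
  ultimately show ?thesis using that by force
qed

definition increasing_upto :: "nat \<Rightarrow> (nat \<Rightarrow> real) \<Rightarrow> bool" where
  "increasing_upto d \<nu> \<longleftrightarrow> (\<forall>i j. i < j \<and> j < d \<longrightarrow> \<nu> i < \<nu> j)"

lemma increasing_uptoD: "increasing_upto d \<nu> \<Longrightarrow> i < j \<Longrightarrow> j < d \<Longrightarrow> \<nu> i < \<nu> j"
  by (auto simp: increasing_upto_def)

lemma increasing_upto_le: "increasing_upto d \<nu> \<Longrightarrow> i \<le> j \<Longrightarrow> j < d \<Longrightarrow> \<nu> i \<le> \<nu> j"
  by (metis increasing_uptoD le_less order_refl)

lemma increasing_upto_inj: "increasing_upto d \<nu> \<Longrightarrow> inj_on \<nu> {..<d}"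
  unfolding increasing_upto_def by (intro inj_onI) (metis lessThan_iff nat_neq_iff less_irrefl)

text \<open>The factor s serves both orientations: \<open>Sd\<close> starts with -1 at 0, the
  auxiliary alternating functions with 1.\<close>

lemma zeros_of_alternation:
  fixes f :: "real \<Rightarrow> real"
  assumes "continuous_on UNIV f" "increasing_upto d \<nu>" "\<forall>j<d. 0 < s * (-1) ^ j * f (\<nu> j)"
  obtains Z where "finite Z" "card Z = d - 1" "\<forall>z\<in>Z. \<nu> 0 < z \<and> f z = 0"
proof -
  have "\<exists>z. \<nu> i < z \<and> z < \<nu> (Suc i) \<and> f z = 0" if "Suc i < d" for i
  proof -
    have "0 < (s * (-1) ^ i * f (\<nu> i)) * (s * (-1) ^ Suc i * f (\<nu> (Suc i)))"
      using assms(3) that by (simp only: mult_pos_pos Suc_lessD)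
    also have "\<dots> = - (s\<^sup>2 * ((-1) ^ i)\<^sup>2) * (f (\<nu> i) * f (\<nu> (Suc i)))"
      by (simp add: power2_eq_square algebra_simps)
    finally have "f (\<nu> i) * f (\<nu> (Suc i)) < 0"
      by (auto simp: mult_less_0_iff zero_less_mult_iff)
    then show ?thesis
      using zero_between[of "\<nu> i" "\<nu> (Suc i)" f] assms(1,2) that
        continuous_on_subset increasing_uptoD by (metis lessI subset_UNIV)
  qed
  then obtain z where z: "\<And>i. Suc i < d \<Longrightarrow> \<nu> i < z i \<and> z i < \<nu> (Suc i) \<and> f (z i) = 0"
    by metis
  have less: "z i < z j" if "i < j" "Suc j < d" for i j
    using z[of i] z[of j] increasing_upto_le[OF assms(2), of "Suc i" j] that by force
  show ?thesis
  proof
    have "inj_on z {..<d - 1}"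
      by (intro inj_onI) (metis less less_diff_conv less_irrefl lessThan_iff nat_neq_iff Suc_eq_plus1)
    then show "card (z ` {..<d - 1}) = d - 1" by (simp add: card_image)
    show "\<forall>y\<in>z ` {..<d - 1}. \<nu> 0 < y \<and> f y = 0"
      using z increasing_upto_le[OF assms(2), of 0]
      by (auto simp: less_diff_conv) (metis Suc_lessD le_less_trans less_eq_nat.simps(1))
  qed simp
qed

lemma full_zeros_of_alternation:
  assumes "f \<in> exp_space hs" "\<forall>h\<in>set hs. 0 < h" "hs \<noteq> []"
    "increasing_upto (length hs) \<nu>" "0 \<le> \<nu> 0" "\<forall>j<length hs. 0 < s * (-1) ^ j * f (\<nu> j)"
  shows "full_zeros hs f"
proof -
  obtain Z where Z: "finite Z" "card Z = length hs - 1" "\<forall>z\<in>Z. \<nu> 0 < z \<and> f z = 0"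
    using zeros_of_alternation[OF exp_space_continuous_on[OF assms(1)] assms(4,6)] .
  have "f (\<nu> 0) \<noteq> 0" using assms(3,6) by force
  moreover have "Suc (card Z) = length hs" using Z(2) assms(3) by (cases hs) auto
  ultimately show ?thesis
    unfolding full_zeros_def using assms(1,2,5) Z by fastforce
qed

text \<open>If the derivative of \<open>p\<close> were larger, then \<open>q - l p\<close> with \<open>\<bar>l\<bar> < 1\<close> would still alternate
  while its derivative of order \<open>k\<close> vanishes at 0.\<close>

lemma alternation_maximizes_deriv:
  assumes p: "p \<in> exp_space hs" and q: "q \<in> exp_space hs" and pos: "\<forall>h\<in>set hs. 0 < h"
    and inc: "increasing_upto (length hs) \<nu>" and "0 \<le> \<nu> 0"
    and alt: "\<forall>j<length hs. 0 < s * (-1) ^ j * q (\<nu> j)" and s: "\<bar>s\<bar> = 1"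
    and le: "\<forall>j<length hs. \<bar>p (\<nu> j)\<bar> \<le> s * (-1) ^ j * q (\<nu> j)"
  shows "\<bar>(deriv ^^ k) p 0\<bar> \<le> \<bar>(deriv ^^ k) q 0\<bar>"
proof (rule ccontr)
  assume less: "\<not> ?thesis"
  then have "hs \<noteq> []" using p q by auto
  define l where "l = (deriv ^^ k) q 0 / (deriv ^^ k) p 0"
  have l: "\<bar>l\<bar> < 1" "(deriv ^^ k) q 0 = l * (deriv ^^ k) p 0" using less by (auto simp: l_def)
  define f where "f = (\<lambda>t. 1 * q t + (- l) * p t)"
  have f: "f \<in> exp_space hs" unfolding f_def by (rule exp_space_linear[OF q p])
  have "0 < s * (-1) ^ j * f (\<nu> j)" if "j < length hs" for j
  proof -
    have "s * (-1) ^ j * (l * p (\<nu> j)) \<le> \<bar>s * (-1) ^ j * (l * p (\<nu> j))\<bar>" by simp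
    also have "\<dots> = \<bar>l\<bar> * \<bar>p (\<nu> j)\<bar>" using s by (simp add: abs_mult power_abs)
    also have "\<dots> \<le> \<bar>l\<bar> * (s * (-1) ^ j * q (\<nu> j))" using le that by (intro mult_left_mono) auto
    also have "\<dots> < 1 * (s * (-1) ^ j * q (\<nu> j))"
      using alt that l by (intro mult_strict_right_mono) auto
    finally show ?thesis by (simp add: f_def algebra_simps)
  qed
  then have "full_zeros hs f"
    using full_zeros_of_alternation[OF f pos \<open>hs \<noteq> []\<close> inc \<open>0 \<le> \<nu> 0\<close>] by blast
  then have "(deriv ^^ k) f 0 \<noteq> 0" using full_zeros_iter_deriv_sign[of hs f k] by auto
  then show False using iter_deriv_linear_exp_space[OF q p, of k 1 "- l"] l(2) by (simp add: f_def)
qed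

section \<open>Monotonicity of the interpolant's derivatives in a single exponent\<close>

lemma derivative_signs_at_consecutive_zeros:
  fixes f :: "real \<Rightarrow> real"
  assumes f: "\<And>t. (f has_real_derivative f' t) (at t)" and "a < b" "f a = 0" "f b = 0"
    and "\<forall>t. a < t \<and> t < b \<longrightarrow> f t \<noteq> 0"
  shows "f' a * f' b \<le> 0"
proof (rule ccontr)
  have cont: "continuous_on S f" for S
    by (meson f continuous_at_imp_continuous_on DERIV_isCont)
  have aux: False if g: "\<And>t. (g has_real_derivative g' t) (at t)" and g0: "g a = 0" "g b = 0"
      and nz: "\<forall>t. a < t \<and> t < b \<longrightarrow> g t \<noteq> 0" and ga: "g' a > 0" and gb: "g' b > 0" for g g' :: "real \<Rightarrow> real"
  proof -
    obtain d where d: "d > 0" "\<And>h. 0 < h \<Longrightarrow> h < d \<Longrightarrow> g a < g (a + h)"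
      using DERIV_pos_inc_right[OF g ga] by blast
    obtain e where e: "e > 0" "\<And>h. 0 < h \<Longrightarrow> h < e \<Longrightarrow> g (b - h) < g b"
      using DERIV_pos_inc_left[OF g gb] by blast
    define m where "m = min (min d e) (b - a) / 3"
    have m: "0 < m" "m < d" "m < e" "a + m < b - m"
      using d(1) e(1) \<open>a < b\<close> by (auto simp: m_def min_def field_simps)
    \<comment> \<open>With both derivatives positive, g is positive just after a and negative just
      before b, so it has a zero in between. A third of the gap keeps the two test points in
      order.\<close>
    have "g (a + m) * g (b - m) < 0"
      using d(2)[of m] e(2)[of m] m g0 by (simp add: mult_pos_neg)
    moreover have "continuous_on {a + m..b - m} g"
      by (meson g continuous_at_imp_continuous_on DERIV_isCont)
    ultimately obtain c where "a + m < c" "c < b - m" "g c = 0"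
      using zero_between[of "a + m" "b - m" g] m by blast
    then show False using nz m by auto
  qed
  assume "\<not> f' a * f' b \<le> 0"
  then consider "f' a > 0" "f' b > 0" | "- f' a > 0" "- f' b > 0"
    by (auto simp: not_le zero_less_mult_iff)
  then show False
  proof cases
    case 1 then show ?thesis using aux[of f f'] assms by blast
  next
    case 2 then show ?thesis
      using aux[of "\<lambda>t. - f t" "\<lambda>t. - f' t"] assms by (auto intro!: derivative_intros)
  qed
qed

text \<open>\<open>f = q - p\<close> has as many zeros as its space allows, so everything is determined by the sign of
  \<open>f'(0)\<close>. If that sign were the one of \<open>q(0)\<close>, then \<open>(D + g) q - (D + h) p\<close>, which lies in the
  smaller space \<open>exp_space hs\<close>, would alternate at all the nodes.\<close>

lemma interpolant_deriv_mono:
  assumes p: "p \<in> exp_space (h # hs)" and q: "q \<in> exp_space (g # hs)"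
    and pos: "0 < h" "h < g" "\<forall>x\<in>set hs. 0 < x"
    and inc: "increasing_upto (Suc (length hs)) \<nu>" and \<nu>0: "\<nu> 0 = 0"
    and pv: "\<forall>j<Suc (length hs). p (\<nu> j) = (-1) ^ j" and qv: "\<forall>j<Suc (length hs). q (\<nu> j) = (-1) ^ j"
  shows "\<bar>(deriv ^^ k) p 0\<bar> \<le> \<bar>(deriv ^^ k) q 0\<bar>"
proof (cases "\<forall>t. q t = p t")
  case True
  then have "q = p" by auto
  then show ?thesis by simp
next
  case False
  define d where "d = Suc (length hs)"
  define f where "f = (\<lambda>t. 1 * q t + (-1) * p t)"
  \<comment> \<open>Both interpolants lie in one space with d + 1 exponents, so their nonzero
    difference has at most d zeros: exactly the nodes, all simple.\<close>
  have p': "p \<in> exp_space (h # g # hs)"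
    using p exp_space_subset_Cons[of "h # hs" g] exp_space_swap[of g h hs] by auto
  have q': "q \<in> exp_space (h # g # hs)" using q exp_space_subset_Cons[of "g # hs" h] by auto
  have f: "f \<in> exp_space (h # g # hs)" unfolding f_def by (rule exp_space_linear[OF q' p'])
  have fz: "f (\<nu> j) = 0" if "j < d" for j using pv qv that by (simp add: f_def d_def)
  define N where "N = \<nu> ` {..<d}"
  have N: "finite N" "card N = d" "\<forall>z\<in>N. f z = 0"
    using increasing_upto_inj[OF inc] fz by (auto simp: N_def card_image d_def)
  have fnz: "\<not> (\<forall>t. f t = 0)" using False by (simp add: f_def)
  have simple: "deriv f (\<nu> j) \<noteq> 0" if "j < d" for j
  proof
    assume "deriv f (\<nu> j) = 0"
    then have "f t = 0" for t
      using N that by (intro exp_space_double_zero[OF f, of N "\<nu> j"]) (auto simp: N_def d_def)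
    then show False using fnz by blast
  qed
  have change: "deriv f (\<nu> j) * deriv f (\<nu> (Suc j)) < 0" if "Suc j < d" for j
  proof -
    have "f t \<noteq> 0" if t: "\<nu> j < t" "t < \<nu> (Suc j)" for t
    proof
      assume "f t = 0"
      have "t \<noteq> \<nu> i" if "i < d" for i
        using t increasing_upto_le[OF inc, of i j] increasing_upto_le[OF inc, of "Suc j" i]
          \<open>Suc j < d\<close> \<open>i < d\<close> by (cases "i \<le> j") (auto simp: d_def)
      then have "t \<notin> N" by (auto simp: N_def)
      then have "f x = 0" for x
        using N \<open>f t = 0\<close> by (intro exp_space_zeros[OF f, of "insert t N"]) (auto simp: d_def)
      then show False using fnz by blast
    qed
    then have "deriv f (\<nu> j) * deriv f (\<nu> (Suc j)) \<le> 0"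
      using fz increasing_uptoD[OF inc, of j "Suc j"] that
      by (intro derivative_signs_at_consecutive_zeros[OF exp_space_DERIV[OF f]]) (auto simp: d_def)
    then show ?thesis using simple[of j] simple[of "Suc j"] that by (simp add: order_le_less)
  qed
  have f'0: "deriv f 0 < 0"
  proof (rule ccontr)
    assume "\<not> ?thesis"
    then have 0: "deriv f (\<nu> 0) > 0" using simple[of 0] \<nu>0 by (simp add: d_def)
    have alt: "0 < (-1) ^ j * deriv f (\<nu> j)" if "j < d" for j
      using that
    proof (induction j)
      case (Suc j)
      then show ?case using change[of j] by (auto simp: zero_less_mult_iff mult_less_0_iff)
    qed (use 0 in simp)
    define w where "w = (\<lambda>t. (deriv q t + g * q t) - (deriv p t + h * p t))"
    have w: "w \<in> exp_space hs" unfolding w_def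
      by (intro exp_space_diff exp_space_ConsD p q)
    have dfq: "deriv f t = deriv q t - deriv p t" for t
      using deriv_linear_exp_space[OF q p, of 1 "-1"] by (simp add: f_def)
    \<comment> \<open>The interpolated values add (g - h) (-1)^j to f', and g > h makes this
      reinforce the alternation. Then w has d - 1 zeros beyond the first node in a space of length d
      - 1, hence vanishes.\<close>
    have w_alt: "0 < 1 * (-1) ^ j * w (\<nu> j)" if "j < d" for j
    proof -
      have "w (\<nu> j) = deriv f (\<nu> j) + (g - h) * (-1) ^ j"
        using pv qv that by (simp add: w_def dfq d_def algebra_simps)
      moreover have "(-1) ^ j * (-1) ^ j = (1 :: real)" by (simp add: power_mult_distrib[symmetric])
      moreover have "1 * s * W = s * D + (g - h)" if "W = D + (g - h) * s" "s * s = 1" for s W D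
        using that by algebra
      ultimately have "1 * (-1) ^ j * w (\<nu> j) = (-1) ^ j * deriv f (\<nu> j) + (g - h)" by blast
      then show ?thesis using alt[OF that] pos by simp
    qed
    obtain Z where Z: "finite Z" "card Z = d - 1" "\<forall>z\<in>Z. \<nu> 0 < z \<and> w z = 0"
      using zeros_of_alternation[OF exp_space_continuous_on[OF w], of d \<nu> 1] inc w_alt
      by (auto simp: d_def)
    have "w (\<nu> 0) = 0" using Z by (intro exp_space_zeros[OF w]) (auto simp: d_def)
    then show False using w_alt[of 0] by (simp add: d_def)
  qed
  have pos_f: "\<forall>x\<in>set (h # g # hs). 0 < x" using pos by auto
  obtain Y where Y: "finite Y" "card Y = card N" "\<forall>y\<in>Y. deriv f y = 0" "\<forall>y\<in>Y. \<exists>z\<in>N. z < y"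
    using Rolle_at_infinity_finite_set[OF N(1) exp_space_DERIV[OF f] N(3)
        exp_space_tendsto_0[OF f pos_f]] by blast
  have N0: "0 \<le> z" if "z \<in> N" for z
    using that increasing_upto_le[OF inc, of 0] \<nu>0 by (auto simp: N_def d_def)
  have "\<forall>y\<in>Y. 0 < y" using Y(4) N0 by (meson le_less_trans)
  moreover have "\<exists>t. deriv f t \<noteq> 0" using f'0 by (metis less_irrefl)
  \<comment> \<open>The d nodes give d positive zeros of f', the maximum for d + 1 exponents, so the
    sign of f' at 0 determines the sign of every higher derivative there.\<close>
  ultimately have "full_zeros (h # g # hs) (deriv f)"
    unfolding full_zeros_def using exp_space_deriv[OF f] pos_f Y N by (auto simp: d_def)
  from full_zeros_iter_deriv_sign[OF this]
  have f_sign: "(-1) ^ k * (deriv ^^ k) f 0 \<ge> 0"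
  proof (cases k)
    case (Suc l)
    show ?thesis
      using \<open>\<And>k. 0 < (-1) ^ k * (deriv ^^ k) (deriv f) 0 * deriv f 0\<close>[of l] f'0
      by (simp add: Suc funpow_Suc_right zero_less_mult_iff del: funpow.simps)
  qed (use fz[of 0] \<nu>0 in \<open>simp add: d_def\<close>)
  have sq: "(-1) ^ j * (-1) ^ j = (1 :: real)" for j by (simp add: power_mult_distrib[symmetric])
  have "full_zeros (h # hs) p"
    using pv inc pos \<nu>0 sq by (intro full_zeros_of_alternation[OF p, of \<nu> 1]) auto
  from full_zeros_iter_deriv_sign[OF this, of k]
  have p_sign: "(-1) ^ k * (deriv ^^ k) p 0 > 0" using pv \<nu>0 by auto
  \<comment> \<open>The derivatives of p and of f = q - p at 0 have the same sign pattern, so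
    passing from p to q can only increase the modulus.\<close>
  have "(-1) ^ k * (deriv ^^ k) q 0 = (-1) ^ k * (deriv ^^ k) p 0 + (-1) ^ k * (deriv ^^ k) f 0"
    using iter_deriv_linear_exp_space[OF q p, of k 1 "-1"] by (simp add: f_def algebra_simps)
  then have "\<bar>(-1) ^ k * (deriv ^^ k) p 0\<bar> \<le> \<bar>(-1) ^ k * (deriv ^^ k) q 0\<bar>"
    using p_sign f_sign by linarith
  then show ?thesis by (simp add: abs_mult power_abs)
qed

text \<open>Exponents are raised to 1 one at a time; i counts those already raised, and
  re-interpolating at the same nodes after each change keeps the comparison going.\<close>

lemma interpolant_deriv_le_equal_exponents:
  assumes "S \<in> exp_space (replicate d 1)" "increasing_upto d \<nu>" "\<nu> 0 = 0"
    and "\<forall>j<d. S (\<nu> j) = (-1) ^ j"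
  shows "p \<in> exp_space (replicate i 1 @ xs) \<Longrightarrow> i + length xs = d \<Longrightarrow> \<forall>x\<in>set xs. 0 < x \<and> x \<le> 1 \<Longrightarrow>
     \<forall>j<d. p (\<nu> j) = (-1) ^ j \<Longrightarrow> \<bar>(deriv ^^ k) p 0\<bar> \<le> \<bar>(deriv ^^ k) S 0\<bar>"
proof (induction xs arbitrary: i p)
  case Nil
  have sq: "(-1) ^ j * (-1) ^ j = (1 :: real)" for j by (simp add: power_mult_distrib[symmetric])
  show ?case
    using assms Nil sq
    by (intro alternation_maximizes_deriv[of _ "replicate d 1" _ \<nu> 1]) (auto simp: power_abs)
next
  case (Cons x xs)
  define V where "V = replicate i 1 @ xs"
  have len: "Suc (length V) = d" using Cons.prems(2) by (simp add: V_def)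
  have p: "p \<in> exp_space (x # V)"
    using Cons.prems(1) exp_space_move[of "replicate i 1" x xs] by (simp add: V_def)
  have posV: "\<forall>x\<in>set V. 0 < x"
    using Cons.prems(3) by (auto simp: V_def set_replicate_conv_if split: if_splits)
  obtain q where q: "q \<in> exp_space (1 # V)" "\<forall>j<d. q (\<nu> j) = (-1) ^ j"
    using exp_space_interpolation[of \<nu> "1 # V" "\<lambda>j. (-1) ^ j"] increasing_upto_inj[OF assms(2)] len
    by auto
  \<comment> \<open>The monotonicity lemma requires a strict increase. For x = 1 both interpolants
    lie in the same space and are compared by alternation.\<close>
  have "\<bar>(deriv ^^ k) p 0\<bar> \<le> \<bar>(deriv ^^ k) q 0\<bar>"
  proof (cases "x = 1")
    case True
    have sq: "(-1) ^ j * (-1) ^ j = (1 :: real)" for j by (simp add: power_mult_distrib[symmetric])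
    show ?thesis
      using assms p q Cons.prems sq len True posV
      by (intro alternation_maximizes_deriv[of _ "1 # V" _ \<nu> 1]) (auto simp: power_abs)
  next
    case False
    then show ?thesis
      using interpolant_deriv_mono[OF p q(1), of \<nu> k] Cons.prems q(2) assms len posV by auto
  qed
  also have "\<dots> \<le> \<bar>(deriv ^^ k) S 0\<bar>"
    using Cons.prems q by (intro Cons.IH[of q "Suc i"]) (auto simp: V_def)
  finally show ?case .
qed

lemma deriv_at_0_le_equal_exponents:
  assumes "S \<in> exp_space (replicate d 1)" "increasing_upto d \<nu>" "\<nu> 0 = 0"
    and "\<forall>j<d. S (\<nu> j) = (-1) ^ j"
    and h: "length h = d" "\<forall>x\<in>set h. 0 < x \<and> x \<le> 1"
    and p: "p \<in> exp_space h" "\<forall>j<d. \<bar>p (\<nu> j)\<bar> \<le> 1"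
  shows "\<bar>(deriv ^^ k) p 0\<bar> \<le> \<bar>(deriv ^^ k) S 0\<bar>"
proof -
  have sq: "(-1) ^ j * (-1) ^ j = (1 :: real)" for j by (simp add: power_mult_distrib[symmetric])
  obtain q where q: "q \<in> exp_space h" "\<forall>j<d. q (\<nu> j) = (-1) ^ j"
    using exp_space_interpolation[of \<nu> h "\<lambda>j. (-1) ^ j"] increasing_upto_inj[OF assms(2)] h
    by auto
  have "\<bar>(deriv ^^ k) p 0\<bar> \<le> \<bar>(deriv ^^ k) q 0\<bar>"
    using assms q sq by (intro alternation_maximizes_deriv[of _ h _ \<nu> 1]) auto
  also have "\<dots> \<le> \<bar>(deriv ^^ k) S 0\<bar>"
    using assms q by (intro interpolant_deriv_le_equal_exponents[OF assms(1-4), of _ 0 h]) auto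
  finally show ?thesis .
qed

section \<open>The Chebyshev polynomial for equal exponents\<close>

lemma poly_eq_sum_lessThan:
  "degree q < d \<Longrightarrow> poly q t = (\<Sum>i<d. coeff q i * t ^ i)" for q :: "real poly"
  unfolding poly_altdef by (rule sum.mono_neutral_left) (auto simp: coeff_eq_0)

lemma poly_exp_in_Pspace:
  assumes "degree q < d"
  shows "(\<lambda>t. poly q t * exp (- t)) \<in> Pspace (replicate d 1)"
proof -
  have "mult_idx (replicate d 1) i = i" if "i < d" for i
  proof -
    have "{j. j < i \<and> replicate d (1::real) ! j = replicate d 1 ! i} = {..<i}" using that by auto
    then show ?thesis by (simp add: mult_idx_def)
  qed
  then have "(\<lambda>t. poly q t * exp (- t)) = (\<lambda>t. \<Sum>i<length (replicate d (1::real)).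
      coeff q i * t ^ mult_idx (replicate d 1) i * exp (- (replicate d 1 ! i) * t))"
    using poly_eq_sum_lessThan[OF assms] by (simp add: sum_distrib_right)
  then show ?thesis unfolding Pspace_def by blast
qed

lemma poly_exp_in_exp_space:
  "degree q < d \<Longrightarrow> (\<lambda>t. poly q t * exp (- t)) \<in> exp_space (replicate d 1)"
  using poly_exp_in_Pspace Pspace_subset_exp_space by blast

text \<open>Splitting off a root z > 0 leaves r with alternating coefficients; in (t - z) r the
  contributions - z r_i and r_(i-1) then have the same sign, so alternation persists with s replaced
  by - s.\<close>

lemma coeffs_alternate:
  fixes q :: "real poly"
  assumes "finite Z" "degree q \<le> card Z" "\<forall>z\<in>Z. 0 < z \<and> poly q z = 0"
  shows "\<exists>s. \<bar>s\<bar> = 1 \<and> (\<forall>i. 0 \<le> s * (-1) ^ i * coeff q i)"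
  using assms
proof (induction Z arbitrary: q rule: finite_induct)
  case empty
  then have 0: "coeff q i = 0" if "i > 0" for i using that by (simp add: coeff_eq_0)
  define s where "s = (if coeff q 0 \<ge> 0 then 1 else - 1 :: real)"
  have "0 \<le> s * (-1) ^ i * coeff q i" for i using 0 by (cases "i = 0") (auto simp: s_def)
  then show ?case by (intro exI[of _ s]) (auto simp: s_def)
next
  case (insert z Z)
  have z: "z > 0" "poly q z = 0" using insert.prems by auto
  then obtain r where r: "q = [:- z, 1:] * r" using poly_eq_0_iff_dvd by blast
  show ?case
  proof (cases "r = 0")
    case False
    then have "degree q = Suc (degree r)" unfolding r by (subst degree_mult_eq) auto
    moreover have "poly r y = 0" if "y \<in> Z" for y
      using insert.prems insert.hyps that by (auto simp: r)
    ultimately obtain s where s: "\<bar>s\<bar> = 1" "\<And>i. 0 \<le> s * (-1) ^ i * coeff r i"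
      using insert.IH[of r] insert.prems insert.hyps by auto
    have "0 \<le> - s * (-1) ^ i * coeff q i" for i
    proof (cases i)
      case 0
      then show ?thesis using s(2)[of 0] z(1) by (simp add: r) (metis mult.left_commute mult_nonneg_nonneg less_imp_le)
    next
      case (Suc j)
      have "- s * (-1) ^ i * coeff q i = z * (s * (-1) ^ i * coeff r i) + s * (-1) ^ j * coeff r j"
        by (simp add: r Suc algebra_simps)
      then show ?thesis using s(2)[of i] s(2)[of j] z(1) by simp
    qed
    then show ?thesis using s(1) by (intro exI[of _ "- s"]) auto
  qed (use r in \<open>auto intro: exI[of _ 1]\<close>)
qed

text \<open>Since the coefficients alternate in sign, \<open>\<bar>q(-1)\<bar>\<close> is their absolute sum.\<close>

lemma coeff_le_poly_minus_1:
  fixes q :: "real poly"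
  assumes "finite Z" "degree q \<le> card Z" "\<forall>z\<in>Z. 0 < z \<and> poly q z = 0"
  shows "\<bar>coeff q i\<bar> \<le> \<bar>poly q (-1)\<bar>"
proof (cases "i \<le> degree q")
  case True
  obtain s where s: "\<bar>s\<bar> = 1" "\<And>i. 0 \<le> s * (-1) ^ i * coeff q i"
    using coeffs_alternate[OF assms] by blast
  have "\<bar>coeff q i\<bar> = \<bar>s * (-1) ^ i * coeff q i\<bar>" using s(1) by (simp add: abs_mult power_abs)
  also have "\<dots> = s * (-1) ^ i * coeff q i" using s(2) by simp
  also have "\<dots> \<le> (\<Sum>i\<le>degree q. s * (-1) ^ i * coeff q i)"
    using True s(2) by (intro member_le_sum) auto
  also have "\<dots> = s * poly q (-1)" by (simp add: poly_altdef sum_distrib_left ac_simps)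
  also have "\<dots> \<le> \<bar>s * poly q (-1)\<bar>" by simp
  also have "\<dots> = \<bar>poly q (-1)\<bar>" using s(1) by (simp add: abs_mult)
  finally show ?thesis .
qed (simp add: coeff_eq_0)

section \<open>Compactness and the minimizing polynomial\<close>

lemma common_convergent_subsequence:
  fixes x :: "nat \<Rightarrow> nat \<Rightarrow> real"
  shows "\<forall>i<m. bounded (range (x i)) \<Longrightarrow> \<exists>r l. strict_mono r \<and> (\<forall>i<m. (\<lambda>k. x i (r k)) \<longlonglongrightarrow> l i)"
proof (induction m)
  case (Suc m)
  then obtain r l where r: "strict_mono r" "\<forall>i<m. (\<lambda>k. x i (r k)) \<longlonglongrightarrow> l i" by auto
  have "bounded (range (\<lambda>k. x m (r k)))"
    by (rule bounded_subset[of "range (x m)"]) (use Suc.prems in auto)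
  then obtain y u where u: "strict_mono u" "(\<lambda>k. x m (r (u k))) \<longlonglongrightarrow> y"
    using bounded_imp_convergent_subsequence[of "\<lambda>k. x m (r k)"] by (auto simp: o_def)
  have "(\<lambda>k. x i ((r \<circ> u) k)) \<longlonglongrightarrow> (l(m := y)) i" if "i < Suc m" for i
    using that u r(2) LIMSEQ_subseq_LIMSEQ[OF _ u(1)] by (auto simp: less_Suc_eq o_def)
  then show ?case using strict_mono_o[OF r(1) u(1)] by blast
qed (auto intro!: exI[of _ id] strict_monoI)

text \<open>A relaxation of the Chebyshev conditions: values of modulus at least 1, and a first node
  that need only be nonnegative. These survive limits; equality is recovered from
  minimality.\<close>

definition admissible :: "nat \<Rightarrow> real poly \<Rightarrow> (nat \<Rightarrow> real) \<Rightarrow> bool" where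
  "admissible d q \<nu> \<longleftrightarrow> degree q < d \<and> increasing_upto d \<nu> \<and> 0 \<le> \<nu> 0 \<and>
     (\<forall>j<d. 1 \<le> (-1) ^ j * (poly q (\<nu> j) * exp (- \<nu> j)))"

lemma admissible_coeff_le:
  assumes "admissible d q \<nu>"
  shows "\<bar>coeff q i\<bar> \<le> \<bar>poly q (-1)\<bar>"
proof -
  have cont: "continuous_on UNIV (\<lambda>t. poly q t * exp (- t))" by (intro continuous_intros)
  have "\<forall>j<d. 0 < 1 * (-1) ^ j * (poly q (\<nu> j) * exp (- \<nu> j))"
    using assms unfolding admissible_def by force
  then obtain Z where "finite Z" "card Z = d - 1" "\<forall>z\<in>Z. \<nu> 0 < z \<and> poly q z * exp (- z) = 0"
    using zeros_of_alternation[OF cont, of d \<nu> 1] assms unfolding admissible_def by blast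
  then show ?thesis using assms
    by (intro coeff_le_poly_minus_1[of Z]) (fastforce simp: admissible_def)+
qed

lemma admissible_exists:
  assumes "1 \<le> d"
  shows "\<exists>q \<nu>. admissible d q \<nu>"
proof -
  \<comment> \<open>Roots at the half-integers 1/2, ..., d - 3/2 separate the nodes 0, ..., d - 1,
    so r has sign (-1)^j at j.\<close>
  define r where "r = (\<Prod>i<d - 1. [:real i + 1 / 2, - 1:])"
  define w where "w = (\<lambda>j. (-1) ^ j * (poly r (real j) * exp (- real j)))"
  have deg: "degree r < d" unfolding r_def
    using degree_prod_sum_le[of "{..<d - 1}" "\<lambda>i. [:real i + 1 / 2, - 1:]"] assms by simp
  have "0 < w j" if "j < d" for j
  proof -
    have "(-1) ^ j = (\<Prod>i<d - 1. if i < j then - 1 else (1 :: real))"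
    proof -
      have "{..<d - 1} \<inter> {i. i < j} = {..<j}" using that by auto
      then show ?thesis by (simp add: prod.If_cases)
    qed
    then have "(-1) ^ j * poly r (real j)
        = (\<Prod>i<d - 1. (if i < j then - 1 else 1) * (real i + 1 / 2 - real j))"
      by (simp add: r_def poly_prod prod.distrib)
    also have "\<dots> > 0" by (intro prod_pos) (auto simp: not_less)
    finally show ?thesis by (simp add: w_def mult.assoc[symmetric])
  qed
  then have w: "\<forall>j<d. 0 < w j" by blast
  \<comment> \<open>The sum exceeds each single 1 / w j, so one scaling lifts all values to at least
    1.\<close>
  define C where "C = (\<Sum>j<d. 1 / w j)"
  have "1 \<le> C * w j" if "j < d" for j
  proof -
    have "1 / w j \<le> C" unfolding C_def using w that
      by (intro member_le_sum[of _ _ "\<lambda>j. 1 / w j"]) (auto intro: less_imp_le)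
    then show ?thesis using w that by (simp add: field_simps)
  qed
  then have "admissible d (smult C r) real"
    unfolding admissible_def increasing_upto_def
    using deg le_less_trans[OF degree_smult_le] by (auto simp: w_def ac_simps)
  then show ?thesis by blast
qed

text \<open>The bound C on all coefficients makes g a majorant on the half-line. It decays below 1,
  whereas an admissible function has modulus at least 1 at its nodes.\<close>

lemma admissible_nodes_bounded:
  "\<exists>R. \<forall>q \<nu>. admissible d q \<nu> \<and> \<bar>poly q (-1)\<bar> \<le> C \<longrightarrow> (\<forall>j<d. \<bar>\<nu> j\<bar> \<le> R)"
proof -
  define g where "g = (\<lambda>t::real. \<Sum>i<d. C * (t ^ i * exp (- 1 * t)))"
  have "g \<in> exp_space (replicate d 1)" unfolding g_def
    by (intro exp_space_sum exp_space_scale power_times_exp_in_exp_space) auto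
  then have "(g \<longlongrightarrow> 0) at_top" by (rule exp_space_tendsto_0) auto
  from tendstoD[OF this, of 1] obtain R where R: "\<And>t. R \<le> t \<Longrightarrow> \<bar>g t\<bar> < 1"
    by (auto simp: eventually_at_top_linorder)
  have "\<bar>\<nu> j\<bar> \<le> R" if adm: "admissible d q \<nu>" and C: "\<bar>poly q (-1)\<bar> \<le> C" and "j < d" for q \<nu> j
  proof (rule ccontr)
    have nonneg: "0 \<le> \<nu> j"
      using adm increasing_upto_le[of d \<nu> 0 j] \<open>j < d\<close> by (force simp: admissible_def)
    assume "\<not> ?thesis"
    then have "\<bar>g (\<nu> j)\<bar> < 1" using R nonneg by auto
    have "1 \<le> \<bar>(-1) ^ j * (poly q (\<nu> j) * exp (- \<nu> j))\<bar>"
      using adm \<open>j < d\<close> by (force simp: admissible_def)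
    also have "\<dots> = \<bar>\<Sum>i<d. coeff q i * \<nu> j ^ i\<bar> * exp (- \<nu> j)"
      using adm by (simp add: abs_mult power_abs admissible_def poly_eq_sum_lessThan[of q d])
    also have "\<dots> \<le> (\<Sum>i<d. C * \<nu> j ^ i) * exp (- \<nu> j)"
    proof (intro mult_right_mono order.trans[OF sum_abs] sum_mono)
      show "\<bar>coeff q i * \<nu> j ^ i\<bar> \<le> C * \<nu> j ^ i" for i
        using order.trans[OF admissible_coeff_le[OF adm] C] nonneg
        by (simp add: abs_mult mult_right_mono)
    qed simp
    also have "\<dots> = g (\<nu> j)" by (simp add: g_def sum_distrib_right mult.assoc)
    finally show False using \<open>\<bar>g (\<nu> j)\<bar> < 1\<close> by simp
  qed
  then show ?thesis by blast
qed

lemma admissible_minimizer: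
  assumes "1 \<le> d"
  obtains q \<nu> where "admissible d q \<nu>"
    "\<forall>p \<mu>. admissible d p \<mu> \<longrightarrow> \<bar>poly q (-1)\<bar> \<le> \<bar>poly p (-1)\<bar>"
proof -
  define J where "J = {\<bar>poly q (-1)\<bar> | q \<nu>. admissible d q \<nu>}"
  define m where "m = Inf J"
  have J: "J \<noteq> {}" "bdd_below J"
    using admissible_exists[OF assms] by (auto simp: J_def intro!: bdd_belowI[of _ 0])
  have "\<exists>q \<nu>. admissible d q \<nu> \<and> \<bar>poly q (-1)\<bar> < m + 1 / real (Suc k)" for k
    using cInf_lessD[OF J(1), of "m + 1 / real (Suc k)"] by (auto simp: m_def J_def)
  then obtain Q V where QV: "\<And>k. admissible d (Q k) (V k)"
    "\<And>k. \<bar>poly (Q k) (-1)\<bar> < m + 1 / real (Suc k)" by metis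
  have le: "\<bar>poly (Q k) (-1)\<bar> \<le> m + 1" for k
  proof -
    have "1 / real (Suc k) \<le> 1" by simp
    then show ?thesis using QV(2)[of k] by linarith
  qed
  obtain R where R: "\<And>q \<nu> j. admissible d q \<nu> \<Longrightarrow> \<bar>poly q (-1)\<bar> \<le> m + 1 \<Longrightarrow> j < d \<Longrightarrow> \<bar>\<nu> j\<bar> \<le> R"
    using admissible_nodes_bounded[of d "m + 1"] by blast
  have "bounded (range (\<lambda>k. coeff (Q k) i))" for i
    using order.trans[OF admissible_coeff_le[OF QV(1)] le]
    by (intro boundedI[of _ "m + 1"]) auto
  moreover have "bounded (range (\<lambda>k. V k j))" if "j < d" for j
    using R[OF QV(1) le that] by (intro boundedI[of _ R]) auto
  \<comment> \<open>The first d entries are the coefficients and the last d the nodes, so that one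
    subsequence serves both.\<close>
  ultimately have "\<forall>i<d + d. bounded (range (\<lambda>k. if i < d then coeff (Q k) i else V k (i - d)))"
    by auto
  from common_convergent_subsequence[OF this] obtain r l where r: "strict_mono r"
    and l: "\<forall>i<d + d. (\<lambda>k. if i < d then coeff (Q (r k)) i else V (r k) (i - d)) \<longlonglongrightarrow> l i"
    by blast
  have c: "(\<lambda>k. coeff (Q (r k)) i) \<longlonglongrightarrow> l i" if "i < d" for i
    using l[rule_format, of i] that by simp
  define \<nu> where "\<nu> = (\<lambda>j. l (d + j))"
  have v: "(\<lambda>k. V (r k) j) \<longlonglongrightarrow> \<nu> j" if "j < d" for j
    using l[rule_format, of "d + j"] that by (simp add: \<nu>_def)
  define q where "q = (\<Sum>i<d. monom (l i) i)"
  have q: "poly q t = (\<Sum>i<d. l i * t ^ i)" for t by (simp add: q_def poly_sum poly_monom)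
  have "degree q \<le> d - 1"
    by (rule degree_le) (use assms in \<open>auto simp: q_def coeff_sum\<close>)
  then have deg: "degree q < d" using assms by simp
  have Qr: "poly (Q (r k)) t = (\<Sum>i<d. coeff (Q (r k)) i * t ^ i)" for k t
    using QV(1)[of "r k"] by (intro poly_eq_sum_lessThan) (auto simp: admissible_def)
  have lim_m: "(\<lambda>k. \<bar>poly (Q (r k)) (-1)\<bar>) \<longlonglongrightarrow> \<bar>poly q (-1)\<bar>"
    unfolding Qr q by (intro tendsto_intros c) auto
  have ge: "1 \<le> (-1) ^ j * (poly q (\<nu> j) * exp (- \<nu> j))" if "j < d" for j
  proof (rule LIMSEQ_le_const)
    show "(\<lambda>k. (-1) ^ j * (poly (Q (r k)) (V (r k) j) * exp (- V (r k) j)))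
        \<longlonglongrightarrow> (-1) ^ j * (poly q (\<nu> j) * exp (- \<nu> j))"
      unfolding Qr q by (intro tendsto_intros c v that) auto
  qed (use QV(1) that in \<open>auto simp: admissible_def\<close>)
  have step: "\<nu> j < \<nu> (Suc j)" if "Suc j < d" for j
  proof -
    have "\<nu> j \<le> \<nu> (Suc j)"
      using that QV(1) by (intro LIMSEQ_le[OF v v]) (auto simp: admissible_def increasing_upto_def less_imp_le)
    \<comment> \<open>Strict order could be lost in the limit, but the function has opposite signs
      at neighbouring limit nodes, so they cannot merge.\<close>
    moreover have "\<nu> j \<noteq> \<nu> (Suc j)" using ge[of j] ge[of "Suc j"] that by auto
    ultimately show ?thesis by simp
  qed
  have "i < j \<Longrightarrow> j < d \<Longrightarrow> \<nu> i < \<nu> j" for i j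
  proof (induction j)
    case (Suc j)
    then show ?case using step[of j] by (cases "i = j") auto
  qed simp
  moreover have "0 \<le> \<nu> 0"
    using assms QV(1) by (intro LIMSEQ_le_const[OF v]) (auto simp: admissible_def)
  ultimately have adm: "admissible d q \<nu>"
    using deg ge by (auto simp: admissible_def increasing_upto_def)
  have "(\<lambda>k. m + 1 / real (Suc (r k))) \<longlonglongrightarrow> m + 0"
    using LIMSEQ_subseq_LIMSEQ[OF LIMSEQ_inverse_real_of_nat r]
    by (intro tendsto_intros) (simp add: o_def inverse_eq_divide)
  then have "\<bar>poly q (-1)\<bar> \<le> m"
    using QV(2) by (intro LIMSEQ_le[OF lim_m]) (auto intro!: less_imp_le)
  moreover have "m \<le> \<bar>poly p (-1)\<bar>" if "admissible d p \<mu>" for p \<mu>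
    unfolding m_def using that J(2) by (intro cInf_lower) (auto simp: J_def)
  ultimately show ?thesis using that adm by force
qed

text \<open>If \<open>q\<close> exceeds 1 strictly at one of its alternation points, subtracting a small multiple of
  the polynomial vanishing at the other points decreases \<open>\<bar>q(-1)\<bar>\<close>.\<close>

lemma minimizer_values:
  assumes min: "\<And>p \<mu>. admissible d p \<mu> \<Longrightarrow> \<bar>poly q (-1)\<bar> \<le> \<bar>poly p (-1)\<bar>"
    and adm: "admissible d q \<nu>" and "k < d"
  shows "poly q (\<nu> k) * exp (- \<nu> k) = (-1) ^ k"
proof -
  have sq: "(-1) ^ k * (-1) ^ k = (1 :: real)" by (simp add: power_mult_distrib[symmetric])
  have "(-1) ^ k * (poly q (\<nu> k) * exp (- \<nu> k)) = 1"
  proof (rule ccontr)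
    assume "\<not> ?thesis"
    define e where "e = (-1) ^ k * (poly q (\<nu> k) * exp (- \<nu> k)) - 1"
    have e: "e > 0"
      using adm \<open>k < d\<close> \<open>\<not> _ = 1\<close> by (force simp: admissible_def e_def)
    have \<nu>_nonneg: "0 \<le> \<nu> j" if "j < d" for j
      using adm increasing_upto_le[of d \<nu> 0 j] that by (force simp: admissible_def)
    define r where "r = (\<Prod>i\<in>{..<d} - {k}. [:- \<nu> i, 1:])"
    have "degree r \<le> card ({..<d} - {k})"
      using degree_prod_sum_le[of "{..<d} - {k}" "\<lambda>i. [:- \<nu> i, 1:]"] by (simp add: r_def)
    then have deg: "degree r < d" using \<open>k < d\<close> by simp
    have r0: "poly r (\<nu> j) = 0" if "j < d" "j \<noteq> k" for j
      unfolding r_def poly_prod using that by (intro prod_zero) auto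
    have r1: "poly r (-1) \<noteq> 0"
      using \<nu>_nonneg by (fastforce simp: r_def poly_prod)
    have q1: "poly q (-1) \<noteq> 0"
    proof
      assume "poly q (-1) = 0"
      then have "q = 0" using admissible_coeff_le[OF adm] by (intro poly_eqI) simp
      then show False using adm \<open>k < d\<close> by (auto simp: admissible_def)
    qed
    \<comment> \<open>Normalized so that p(-1) = (1 - x) q(-1); the nodes are nonnegative, hence r
      does not vanish at -1.\<close>
    define c where "c = poly q (-1) / poly r (-1)"
    \<comment> \<open>Small enough that the value at node k loses at most its excess e over
      1.\<close>
    define x where "x = min 1 (e / (1 + \<bar>c * poly r (\<nu> k)\<bar>))"
    have x: "0 < x" "x \<le> 1" using e by (auto simp: x_def)
    define p where "p = q - smult (x * c) r"
    have "1 \<le> (-1) ^ j * (poly p (\<nu> j) * exp (- \<nu> j))" if "j < d" for j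
    proof (cases "j = k")
      case True
      have "\<bar>(-1) ^ k * (x * c * poly r (\<nu> k) * exp (- \<nu> k))\<bar> = x * \<bar>c * poly r (\<nu> k)\<bar> * exp (- \<nu> k)"
        using x by (simp add: abs_mult power_abs)
      also have "\<dots> \<le> x * \<bar>c * poly r (\<nu> k)\<bar> * 1"
        using x \<nu>_nonneg[OF \<open>k < d\<close>] by (intro mult_left_mono) auto
      also have "\<dots> \<le> x * (1 + \<bar>c * poly r (\<nu> k)\<bar>)" using x by simp
      also have "\<dots> \<le> e / (1 + \<bar>c * poly r (\<nu> k)\<bar>) * (1 + \<bar>c * poly r (\<nu> k)\<bar>)"
        by (intro mult_right_mono) (auto simp: x_def)
      also have "\<dots> = e" by (intro nonzero_eq_divide_eq[THEN iffD1, OF _ refl]) (use abs_ge_zero[of "c * poly r (\<nu> k)"] in linarith)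
      finally have "(-1) ^ k * (x * c * poly r (\<nu> k) * exp (- \<nu> k)) \<le> e" by linarith
      then show ?thesis unfolding True p_def e_def by (simp add: algebra_simps)
    next
      case False
      then show ?thesis using adm that r0 by (simp add: p_def admissible_def)
    qed
    moreover have "degree p < d" unfolding p_def
      using adm deg by (intro degree_diff_less le_less_trans[OF degree_smult_le])
        (auto simp: admissible_def)
    ultimately have "admissible d p \<nu>" using adm by (simp add: admissible_def)
    from min[OF this] have "\<bar>poly q (-1)\<bar> \<le> \<bar>(1 - x) * poly q (-1)\<bar>"
      using r1 by (simp add: p_def c_def algebra_simps)
    also have "\<dots> = (1 - x) * \<bar>poly q (-1)\<bar>" using x by (simp add: abs_mult)
    also have "\<dots> < 1 * \<bar>poly q (-1)\<bar>" using x q1 by (intro mult_strict_right_mono) auto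
    finally show False by simp
  qed
  moreover have "y = x" if "x * y = 1" "x * x = 1" for x y :: real using that by algebra
  ultimately show ?thesis using sq by blast
qed

section \<open>Exchange of alternation points and existence of the Chebyshev polynomial\<close>

lemma increasing_upto_update:
  assumes "increasing_upto d \<nu>" "\<And>i. i < j \<Longrightarrow> \<nu> i < x" "\<And>i. j < i \<Longrightarrow> i < d \<Longrightarrow> x < \<nu> i"
  shows "increasing_upto d (\<nu>(j := x))"
  using assms by (auto simp: increasing_upto_def)

lemma poly_exp_no_full_alternation:
  assumes "degree q < d" "increasing_upto (Suc d) \<mu>"
  shows "\<not> (\<forall>j<Suc d. 0 < s * (-1) ^ j * (poly q (\<mu> j) * exp (- \<mu> j)))"
proof
  assume alt: "\<forall>j<Suc d. 0 < s * (-1) ^ j * (poly q (\<mu> j) * exp (- \<mu> j))"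
  have cont: "continuous_on UNIV (\<lambda>t. poly q t * exp (- t))" by (intro continuous_intros)
  obtain Z where "finite Z" "card Z = Suc d - 1" "\<forall>z\<in>Z. \<mu> 0 < z \<and> poly q z * exp (- z) = 0"
    using zeros_of_alternation[OF cont assms(2) alt] .
  then have "poly q (\<mu> 0) * exp (- \<mu> 0) = 0"
    by (intro exp_space_zeros[OF poly_exp_in_exp_space[OF assms(1)], of Z]) auto
  then show False using alt by auto
qed

text \<open>The exchange step of the Remez algorithm: x replaces a neighbouring node of the same
  sign. Only before the first or after the last node can such a neighbour be missing, and then x
  would extend the alternation to d + 1 points, which the degree forbids.\<close>

lemma admissible_exchange:
  assumes adm: "admissible d q \<nu>" and "1 \<le> d" and "0 \<le> x" and gt: "1 < \<bar>poly q x * exp (- x)\<bar>"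
  obtains \<mu> k where "admissible d q \<mu>" "k < d" "\<mu> k = x"
proof -
  note found = that
  define f where "f = (\<lambda>t. poly q t * exp (- t))"
  have deg: "degree q < d" and inc: "increasing_upto d \<nu>" and \<nu>0: "0 \<le> \<nu> 0"
    and alt: "\<And>j. j < d \<Longrightarrow> 1 \<le> (-1) ^ j * f (\<nu> j)"
    using adm by (auto simp: admissible_def f_def)
  have fx: "1 < (-1) ^ j * f x" if "0 < (-1) ^ j * f x" for j :: nat
  proof -
    have "\<bar>(-1) ^ j * f x\<bar> = \<bar>f x\<bar>" by (simp add: abs_mult power_abs)
    then show ?thesis using gt that by (simp add: f_def)
  qed
  have fx_cases: "0 < (-1) ^ j * f x \<or> 0 < (-1) ^ Suc j * f x" for j :: nat
    using gt by (cases "even j") (auto simp: f_def)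
  have update: thesis
    if "k < d" "\<And>i. i < k \<Longrightarrow> \<nu> i < x" "\<And>i. k < i \<Longrightarrow> i < d \<Longrightarrow> x < \<nu> i" "0 < (-1) ^ k * f x" for k
  proof -
    have "increasing_upto d (\<nu>(k := x))" by (intro increasing_upto_update inc that(2,3))
    moreover have "0 \<le> (\<nu>(k := x)) 0" using \<nu>0 \<open>0 \<le> x\<close> by simp
    moreover have "1 \<le> (-1) ^ j * f ((\<nu>(k := x)) j)" if "j < d" for j
      using alt[OF that] fx[OF \<open>0 < (-1) ^ k * f x\<close>] by (cases "j = k") auto
    ultimately have "admissible d q (\<nu>(k := x))" using deg by (simp add: admissible_def f_def)
    then show thesis using that(1) by (rule found) simp
  qed
  have no_alt: False
    if "increasing_upto (Suc d) \<mu>" "\<And>j. j < Suc d \<Longrightarrow> 0 < s * (-1) ^ j * f (\<mu> j)" for \<mu> s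
    using poly_exp_no_full_alternation[OF deg that(1)] that(2) unfolding f_def by blast
  show thesis
  proof (cases "x < \<nu> 0")
    case True
    have less: "x < \<nu> i" if "i < d" for i using True increasing_upto_le[OF inc, of 0 i] that by simp
    show thesis
    proof (cases "0 < f x")
      case True
      then show ?thesis using less update[of 0] \<open>1 \<le> d\<close> by simp
    next
      case False
      define \<mu> where "\<mu> = (\<lambda>j. case j of 0 \<Rightarrow> x | Suc i \<Rightarrow> \<nu> i)"
      have "increasing_upto (Suc d) \<mu>"
        using less inc by (auto simp: increasing_upto_def \<mu>_def split: nat.split)
      moreover have "0 < (- 1) * (-1) ^ j * f (\<mu> j)" if "j < Suc d" for j
        using that alt[of "j - 1"] False fx_cases[of 0] by (cases j) (auto simp: \<mu>_def)
      ultimately show ?thesis using no_alt by blast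
    qed
  next
    case False
    define A where "A = {j. j < d \<and> \<nu> j \<le> x}"
    define k where "k = Max A"
    have A: "finite A" "A \<noteq> {}" using False \<open>1 \<le> d\<close> by (auto simp: A_def intro: exI[of _ 0])
    have k: "k < d" "\<nu> k \<le> x" using Max_in[OF A] by (auto simp: k_def A_def)
    have above: "x < \<nu> i" if "k < i" "i < d" for i
      using that A Max_ge[OF A(1), of i] by (force simp: A_def k_def)
    have below: "\<nu> i < x" if "i < k" for i
      using increasing_uptoD[OF inc that k(1)] k(2) by simp
    show thesis
    proof (cases "0 < (-1) ^ k * f x")
      case True
      then show ?thesis using update[of k] k above below by blast
    next
      case False
      then have fx': "0 < (-1) ^ Suc k * f x" using fx_cases by blast
      have "\<nu> k \<noteq> x" using alt[OF k(1)] False by auto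
      then have below': "\<nu> i < x" if "i < Suc k" for i using k below that by (auto simp: less_Suc_eq)
      show ?thesis
      proof (cases "Suc k < d")
        case True
        then show ?thesis using update[of "Suc k"] fx' below' above by (meson Suc_lessD)
      next
        case False
        then have "Suc k = d" using k by simp
        have "increasing_upto (Suc d) (\<nu>(d := x))"
          using inc below' \<open>Suc k = d\<close> by (auto simp: increasing_upto_def less_Suc_eq)
        moreover have "0 < 1 * (-1) ^ j * f ((\<nu>(d := x)) j)" if "j < Suc d" for j
          using that alt[of j] fx' \<open>Suc k = d\<close> by (auto simp: less_Suc_eq)
        ultimately show ?thesis using no_alt by blast
      qed
    qed
  qed
qed

text \<open>A point with |f x| > 1 could be exchanged into the alternation of the same minimizer,
  where minimality forces modulus 1. If \<open>\<nu> 0\<close> were positive, all d nodes would be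
  interior maxima of |f|, so f' would have d zeros and f would be constant although it tends to
  0.\<close>

lemma chebyshev_polynomial_exists:
  assumes "1 \<le> d"
  obtains S \<nu> where "S \<in> Pspace (replicate d 1)" "increasing_upto d \<nu>" "\<nu> 0 = 0"
    "\<forall>j<d. S (\<nu> j) = (-1) ^ j" "\<forall>t\<ge>0. \<bar>S t\<bar> \<le> 1"
proof -
  obtain q \<nu> where adm: "admissible d q \<nu>"
    and min: "\<forall>p \<mu>. admissible d p \<mu> \<longrightarrow> \<bar>poly q (-1)\<bar> \<le> \<bar>poly p (-1)\<bar>"
    using admissible_minimizer[OF assms] .
  define f where "f = (\<lambda>t. poly q t * exp (- t))"
  have deg: "degree q < d" and inc: "increasing_upto d \<nu>" and \<nu>0: "0 \<le> \<nu> 0"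
    using adm by (auto simp: admissible_def)
  have val: "f (\<nu> j) = (-1) ^ j" if "j < d" for j
    using minimizer_values[OF min[rule_format] adm that] by (simp add: f_def)
  have le: "\<bar>f x\<bar> \<le> 1" if x: "0 \<le> x" for x
  proof (rule ccontr)
    assume "\<not> ?thesis"
    then obtain \<mu> k where \<mu>: "admissible d q \<mu>" "k < d" "\<mu> k = x"
      using admissible_exchange[OF adm assms x] by (auto simp: f_def)
    have "\<bar>f x\<bar> = 1"
      using minimizer_values[OF min[rule_format] \<mu>(1,2)] \<mu>(3) by (simp add: f_def power_abs)
    then show False using \<open>\<not> \<bar>f x\<bar> \<le> 1\<close> by simp
  qed
  have f: "f \<in> exp_space (replicate d 1)" unfolding f_def by (rule poly_exp_in_exp_space[OF deg])
  have "\<nu> 0 = 0"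
  proof (rule ccontr)
    assume "\<nu> 0 \<noteq> 0"
    then have pos: "0 < \<nu> j" if "j < d" for j
      using \<nu>0 increasing_upto_le[OF inc, of 0 j] that by simp
    have crit: "deriv f (\<nu> j) = 0" if "j < d" for j
    proof -
      have "((\<lambda>t. (-1) ^ j * f t) has_real_derivative (-1) ^ j * deriv f (\<nu> j)) (at (\<nu> j))"
        by (intro DERIV_cmult exp_space_DERIV[OF f])
      moreover have "(-1) ^ j * f y \<le> (-1) ^ j * f (\<nu> j)" if "\<bar>\<nu> j - y\<bar> < \<nu> j" for y
      proof -
        have "(-1) ^ j * f y \<le> \<bar>(-1) ^ j * f y\<bar>" by simp
        also have "\<dots> \<le> 1" using le[of y] that by (simp add: abs_mult power_abs)
        also have "\<dots> = (-1) ^ j * f (\<nu> j)"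
          using val[OF \<open>j < d\<close>] by (simp add: power_mult_distrib[symmetric])
        finally show ?thesis .
      qed
      ultimately have "(-1) ^ j * deriv f (\<nu> j) = 0"
        using DERIV_local_max pos[OF that] by blast
      then show ?thesis by simp
    qed
    have "deriv f t = 0" for t
      using crit increasing_upto_inj[OF inc]
      by (intro exp_space_zeros[OF exp_space_deriv[OF f], of "\<nu> ` {..<d}"]) (auto simp: card_image)
    then have "f t = f (\<nu> 0)" for t
      using exp_space_DERIV[OF f] by (intro DERIV_isconst_all) auto
    then have "(f \<longlongrightarrow> f (\<nu> 0)) at_top" by (intro tendsto_eventually always_eventually allI)
    moreover have "(f \<longlongrightarrow> 0) at_top" by (rule exp_space_tendsto_0[OF f]) simp
    ultimately have "f (\<nu> 0) = 0" using tendsto_unique[of at_top f] by simp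
    then show False using val[of 0] assms by simp
  qed
  then show ?thesis
    using that[of f \<nu>] poly_exp_in_Pspace[OF deg] inc val le by (auto simp: f_def)
qed

section \<open>Sup norm, uniqueness and extremality of \<open>Sd\<close>\<close>

lemma bdd_above_exp_space:
  assumes "f \<in> exp_space hs" "\<forall>h\<in>set hs. 0 < h"
  shows "bdd_above ((\<lambda>t. \<bar>f t\<bar>) ` {0..})"
proof -
  from tendstoD[OF exp_space_tendsto_0[OF assms], of 1]
  obtain R where R: "\<And>t. R \<le> t \<Longrightarrow> \<bar>f t\<bar> < 1" by (auto simp: eventually_at_top_linorder)
  have "compact (f ` {0..R})"
    by (intro compact_continuous_image exp_space_continuous_on[OF assms(1)]) simp
  then obtain B where B: "\<forall>y\<in>f ` {0..R}. \<bar>y\<bar> \<le> B"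
    using compact_imp_bounded[of "f ` {0..R}"] by (auto simp: bounded_iff)
  have "\<bar>f t\<bar> \<le> max B 1" if "0 \<le> t" for t
    using B R[of t] that by (cases "t \<le> R") (force simp: le_max_iff_disj)+
  then show ?thesis by (intro bdd_aboveI2[of _ _ "max B 1"]) auto
qed

lemma le_supRp:
  "f \<in> exp_space hs \<Longrightarrow> \<forall>h\<in>set hs. 0 < h \<Longrightarrow> 0 \<le> t \<Longrightarrow> \<bar>f t\<bar> \<le> supRp f"
  unfolding supRp_def by (intro cSUP_upper bdd_above_exp_space) auto

lemma supRp_le: "(\<And>t. 0 \<le> t \<Longrightarrow> \<bar>f t\<bar> \<le> M) \<Longrightarrow> supRp f \<le> M"
  unfolding supRp_def by (intro cSUP_least) auto

lemma supRp_uminus: "supRp (\<lambda>t. - f t) = supRp f"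
  by (simp add: supRp_def)

text \<open>Each candidate alternates at its own nodes and is bounded by 1 at those of the other, so
  the moduli of all derivatives at 0 agree. Their signs are fixed by
  \<open>full_zeros_iter_deriv_sign\<close>, hence all derivatives of T - U vanish at 0.\<close>

lemma cheb_equal_exponents_unique:
  assumes "T \<in> exp_space (replicate d 1)" "supRp T = 1" "increasing_upto d \<mu>" "\<mu> 0 = 0"
      "\<forall>j<d. T (\<mu> j) = (-1) ^ (j + 1)"
    and "U \<in> exp_space (replicate d 1)" "supRp U = 1" "increasing_upto d \<nu>" "\<nu> 0 = 0"
      "\<forall>j<d. U (\<nu> j) = (-1) ^ (j + 1)"
    and "1 \<le> d"
  shows "T = U"
proof -
  have sq: "(-1) ^ j * (-1) ^ j = (1 :: real)" for j by (simp add: power_mult_distrib[symmetric])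
  have main: "\<bar>(deriv ^^ k) T 0\<bar> \<le> \<bar>(deriv ^^ k) U 0\<bar>"
      "0 < (-1) ^ k * (deriv ^^ k) U 0 * (- 1)"
    if "T \<in> exp_space (replicate d 1)" "supRp T = 1"
      and "U \<in> exp_space (replicate d 1)" "increasing_upto d \<nu>" "\<nu> 0 = 0"
      "\<forall>j<d. U (\<nu> j) = (-1) ^ (j + 1)" for T U \<nu> k
  proof -
    have "\<bar>T t\<bar> \<le> 1" if "0 \<le> t" for t
      using le_supRp[of T "replicate d 1" t] that \<open>T \<in> _\<close> \<open>supRp T = 1\<close> by simp
    moreover have "0 \<le> \<nu> j" if "j < d" for j
      using increasing_upto_le[OF \<open>increasing_upto d \<nu>\<close>, of 0 j] that \<open>\<nu> 0 = 0\<close> by simp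
    ultimately show "\<bar>(deriv ^^ k) T 0\<bar> \<le> \<bar>(deriv ^^ k) U 0\<bar>"
      using that sq by (intro alternation_maximizes_deriv[of T "replicate d 1" U \<nu> "-1"]) auto
    have "full_zeros (replicate d 1) U"
      using that sq \<open>1 \<le> d\<close> by (intro full_zeros_of_alternation[of _ _ \<nu> "-1"]) auto
    then show "0 < (-1) ^ k * (deriv ^^ k) U 0 * (- 1)"
      using full_zeros_iter_deriv_sign[of "replicate d 1" U k] \<open>\<nu> 0 = 0\<close>
        \<open>\<forall>j<d. U (\<nu> j) = (-1) ^ (j + 1)\<close>[rule_format, of 0] \<open>1 \<le> d\<close> by simp
  qed
  have eq: "(deriv ^^ k) T 0 = (deriv ^^ k) U 0" for k
  proof -
    have "\<bar>(deriv ^^ k) T 0\<bar> = \<bar>(deriv ^^ k) U 0\<bar>"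
      using main(1)[OF assms(1,2,6,8,9,10)] main(1)[OF assms(6,7,1,3,4,5)] by (intro antisym)
    then show ?thesis
      using main(2)[OF assms(1,2,6,8,9,10), of k] main(2)[OF assms(6,7,1,3,4,5), of k]
      by (auto simp: abs_if zero_less_mult_iff mult_less_0_iff split: if_splits)
  qed
  have "1 * T t + (- 1) * U t = 0" for t
  proof (rule exp_space_all_derivs_zero[of "\<lambda>t. 1 * T t + (- 1) * U t" "replicate d 1" 0])
    show "(\<lambda>t. 1 * T t + (- 1) * U t) \<in> exp_space (replicate d 1)"
      by (intro exp_space_linear assms)
    show "\<forall>k. (deriv ^^ k) (\<lambda>t. 1 * T t + (- 1) * U t) 0 = 0"
      using eq by (subst iter_deriv_linear_exp_space[OF assms(1,6)]) simp
  qed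
  then show ?thesis by (intro ext) (simp add: algebra_simps)
qed

lemma Sd_props:
  assumes "1 \<le> d"
  obtains \<nu> where "Sd d \<in> Pspace (replicate d 1)" "supRp (Sd d) = 1" "increasing_upto d \<nu>" "\<nu> 0 = 0"
    "\<forall>j<d. Sd d (\<nu> j) = (-1) ^ (j + 1)"
proof -
  let ?P = "\<lambda>T. T \<in> Pspace (replicate d 1) \<and> supRp T = 1 \<and> (\<exists>\<nu>. \<nu> 0 = 0 \<and>
     increasing_upto d \<nu> \<and> (\<forall>j<d. T (\<nu> j) = (-1) ^ (j + 1)))"
  have Sd: "Sd d = (THE T. ?P T)"
    by (simp add: Sd_def cheb_def increasing_upto_def)
  obtain S \<nu> where S: "S \<in> Pspace (replicate d 1)" "increasing_upto d \<nu>" "\<nu> 0 = 0"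
    "\<forall>j<d. S (\<nu> j) = (-1) ^ j" "\<forall>t\<ge>0. \<bar>S t\<bar> \<le> 1"
    using chebyshev_polynomial_exists[OF assms] .
  \<comment> \<open>The Chebyshev polynomial is normalized to -1 at 0, while S takes the value 1
    there; the witness is therefore - S.\<close>
  have neg: "(\<lambda>t. - S t) \<in> Pspace (replicate d 1)"
  proof -
    obtain c where c: "S = (\<lambda>t. \<Sum>i<length (replicate d (1::real)).
        c i * t ^ mult_idx (replicate d 1) i * exp (- (replicate d 1 ! i) * t))"
      using S(1) by (auto simp: Pspace_def)
    show ?thesis unfolding Pspace_def c
      by (intro CollectI exI[of _ "\<lambda>i. - c i"]) (simp add: sum_negf)
  qed
  have "1 = \<bar>S 0\<bar>" using S(3,4) assms by force
  also have "\<dots> \<le> supRp S" using S(1) Pspace_subset_exp_space by (intro le_supRp) auto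
  finally have "supRp S = 1" using supRp_le[of S 1] S(5) by (intro antisym) auto
  then have "?P (\<lambda>t. - S t)" using neg S by (auto simp: supRp_uminus)
  moreover have "T = (\<lambda>t. - S t)" if "?P T" for T
  proof -
    obtain \<mu> where \<mu>: "\<mu> 0 = 0" "increasing_upto d \<mu>" "\<forall>j<d. T (\<mu> j) = (-1) ^ (j + 1)"
      using \<open>?P T\<close> by blast
    have "T \<in> exp_space (replicate d 1)" "(\<lambda>t. - S t) \<in> exp_space (replicate d 1)"
      using \<open>?P T\<close> neg Pspace_subset_exp_space by blast+
    then show ?thesis
      using cheb_equal_exponents_unique[of T d \<mu> "\<lambda>t. - S t" \<nu>] \<mu> S \<open>?P T\<close> assms
        \<open>supRp S = 1\<close> by (simp add: supRp_uminus)
  qed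
  ultimately have "?P (Sd d)" unfolding Sd by (rule theI)
  then show ?thesis using that by blast
qed

lemma iter_deriv_uminus_exp_space:
  "f \<in> exp_space hs \<Longrightarrow> (deriv ^^ k) (\<lambda>t. - f t) = (\<lambda>t. - (deriv ^^ k) f t)"
  using iter_deriv_linear_exp_space[of f hs f hs k "-1" 0] by simp

lemma iter_deriv_le_Sd_at_0:
  assumes "1 \<le> d" "h \<in> Delta d" "p \<in> Pspace h" "supRp p \<le> 1" "0 \<le> t"
  shows "\<bar>(deriv ^^ k) p t\<bar> \<le> \<bar>(deriv ^^ k) (Sd d) 0\<bar>"
proof -
  obtain \<nu> where S: "Sd d \<in> Pspace (replicate d 1)" "increasing_upto d \<nu>" "\<nu> 0 = 0"
    "\<forall>j<d. Sd d (\<nu> j) = (-1) ^ (j + 1)"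
    using Sd_props[OF assms(1)] by metis
  have Se: "Sd d \<in> exp_space (replicate d 1)" using S(1) Pspace_subset_exp_space by blast
  have h: "length h = d" "\<forall>x\<in>set h. 0 < x \<and> x \<le> 1" using assms(2) by (auto simp: Delta_def)
  have p: "p \<in> exp_space h" using assms(3) Pspace_subset_exp_space by blast
  define r where "r = (\<lambda>s. p (s + t))"
  have r: "r \<in> exp_space h" unfolding r_def by (rule exp_space_shift[OF p])
  have "\<bar>r s\<bar> \<le> 1" if "0 \<le> s" for s
    using le_supRp[OF p, of "s + t"] h(2) that assms(4,5) by (simp add: r_def)
  moreover have "0 \<le> \<nu> j" if "j < d" for j
    using increasing_upto_le[OF S(2), of 0 j] that S(3) by simp
  ultimately have "\<bar>(deriv ^^ k) r 0\<bar> \<le> \<bar>(deriv ^^ k) (\<lambda>t. - Sd d t) 0\<bar>"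
    using exp_space_scale[OF Se, of "-1"] S
    by (intro deriv_at_0_le_equal_exponents[OF _ S(2,3) _ h r]) auto
  then show ?thesis
    by (simp add: r_def iter_deriv_shift iter_deriv_uminus_exp_space[OF Se])
qed

lemma supRp_iter_deriv_Sd:
  assumes "1 \<le> d"
  shows "supRp ((deriv ^^ k) (Sd d)) = \<bar>(deriv ^^ k) (Sd d) 0\<bar>"
proof (rule antisym)
  have S: "Sd d \<in> Pspace (replicate d 1)" "supRp (Sd d) = 1" using Sd_props[OF assms] by metis+
  have "replicate d 1 \<in> Delta d" by (auto simp: Delta_def)
  then show "supRp ((deriv ^^ k) (Sd d)) \<le> \<bar>(deriv ^^ k) (Sd d) 0\<bar>"
    using iter_deriv_le_Sd_at_0[OF assms _ S(1)] S(2) by (intro supRp_le) auto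
  show "\<bar>(deriv ^^ k) (Sd d) 0\<bar> \<le> supRp ((deriv ^^ k) (Sd d))"
    using S(1) Pspace_subset_exp_space
    by (intro le_supRp[OF exp_space_iter_deriv[of _ "replicate d 1"]]) auto
qed

lemma supRp_iter_deriv_le_Sd:
  assumes "1 \<le> d" "h \<in> Delta d" "p \<in> Pspace h" "supRp p \<le> 1"
  shows "supRp ((deriv ^^ k) p) \<le> supRp ((deriv ^^ k) (Sd d))"
  unfolding supRp_iter_deriv_Sd[OF assms(1)]
  using iter_deriv_le_Sd_at_0[OF assms] by (rule supRp_le)

lemma Mkd_eq:
  assumes "1 \<le> d"
  shows "Mkd k d = \<bar>(deriv ^^ k) (Sd d) 0\<bar>"
proof -
  have "replicate d 1 \<in> Delta d" by (auto simp: Delta_def)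
  then have "Mkd k d = supRp ((deriv ^^ k) (Sd d))"
    unfolding Mkd_def Mk_def
  proof (intro cSup_eq_maximum)
    have "Sd d \<in> Pspace (replicate d 1)" "supRp (Sd d) \<le> 1"
      using Sd_props[OF assms] by (metis order_refl)+
    then show "supRp ((deriv ^^ k) (Sd d))
        \<in> {supRp ((deriv ^^ k) p) |p. p \<in> Pspace (replicate d 1) \<and> supRp p \<le> 1}" by blast
  qed (use supRp_iter_deriv_le_Sd[OF assms] in blast)
  then show ?thesis using supRp_iter_deriv_Sd[OF assms] by simp
qed

section \<open>Laguerre and Hermite polynomials\<close>

text \<open>The Laguerre polynomial of degree m and parameter a, at the argument 2 t and normalized
  to 1 at 0.\<close>

definition laguerre :: "nat \<Rightarrow> real \<Rightarrow> real poly" where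
  "laguerre m a = (\<Sum>i\<le>m. monom (real (m choose i) * (-2) ^ i / pochhammer (a + 1) i) i)"

lemma coeff_laguerre: "coeff (laguerre m a) i = real (m choose i) * (-2) ^ i / pochhammer (a + 1) i"
  by (simp add: laguerre_def coeff_sum not_le binomial_eq_0)

lemma degree_laguerre: "degree (laguerre m a) \<le> m"
  by (rule degree_le) (simp add: coeff_laguerre binomial_eq_0)

lemma poly_laguerre_0: "poly (laguerre m a) 0 = 1"
  by (simp add: poly_0_coeff_0 coeff_laguerre)

text \<open>The Rodrigues-type relation D (t^(a+1) exp(- 2 t) L) = (a + 1) t^a exp(- 2 t) M, with L
  of degree m and parameter a + 1 and M of degree m + 1 and parameter a, after cancelling t^a exp(-
  2 t).\<close>

lemma laguerre_raise:
  assumes "-1 < a"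
  shows "smult (a + 1) (laguerre (Suc m) a) =
    pCons 0 (pderiv (laguerre m (a + 1))) + smult (a + 1) (laguerre m (a + 1))
      - smult 2 (pCons 0 (laguerre m (a + 1)))"
proof (rule poly_eqI)
  fix i
  show "coeff (smult (a + 1) (laguerre (Suc m) a)) i =
    coeff (pCons 0 (pderiv (laguerre m (a + 1))) + smult (a + 1) (laguerre m (a + 1))
      - smult 2 (pCons 0 (laguerre m (a + 1)))) i"
  proof (cases i)
    case 0 then show ?thesis by (simp add: coeff_laguerre)
  next
    case (Suc j)
    define P where "P = pochhammer (a + 1 + 1) j"
    have nz: "P \<noteq> 0" "a + 1 \<noteq> 0" "a + 1 + 1 + real j \<noteq> 0"
      using assms pochhammer_pos[of "a + 1 + 1" j] by (auto simp: P_def)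
    have p1: "pochhammer (a + 1) (Suc j) = (a + 1) * P" by (simp add: pochhammer_rec P_def)
    have p2: "pochhammer (a + 1 + 1) (Suc j) = P * (a + 1 + 1 + real j)"
      by (simp add: pochhammer_Suc P_def)
    define B where "B = real (m choose Suc j)"
    define C where "C = real (m choose j)"
    have "coeff (smult (a + 1) (laguerre (Suc m) a)) i = (C + B) * (-2) ^ Suc j / P"
      unfolding Suc coeff_smult coeff_laguerre p1 using nz by (simp add: B_def C_def)
    moreover have "coeff (pCons 0 (pderiv (laguerre m (a + 1))) + smult (a + 1) (laguerre m (a + 1))
      - smult 2 (pCons 0 (laguerre m (a + 1)))) i =
      real (Suc j) * (B * (-2) ^ Suc j / (P * (a + 1 + 1 + real j)))
       + (a + 1) * (B * (-2) ^ Suc j / (P * (a + 1 + 1 + real j))) - 2 * (C * (-2) ^ j / P)"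
      unfolding Suc coeff_add coeff_diff coeff_smult coeff_pCons_Suc coeff_pderiv coeff_laguerre p2
      by (simp only: B_def C_def P_def)
    moreover have "\<dots> = (C + B) * (-2) ^ Suc j / P"
    proof -
      have "real (Suc j) * y + (a + 1) * y = (a + 1 + 1 + real j) * y" for y
        by (simp add: algebra_simps)
      then have "real (Suc j) * (B * (-2) ^ Suc j / (P * (a + 1 + 1 + real j)))
         + (a + 1) * (B * (-2) ^ Suc j / (P * (a + 1 + 1 + real j)))
         = (a + 1 + 1 + real j) * (B * (-2) ^ Suc j / (P * (a + 1 + 1 + real j)))" .
      also have "\<dots> = B * (-2) ^ Suc j / P" using nz by simp
      finally have eq: "real (Suc j) * (B * (-2) ^ Suc j / (P * (a + 1 + 1 + real j)))
         + (a + 1) * (B * (-2) ^ Suc j / (P * (a + 1 + 1 + real j))) = B * (-2) ^ Suc j / P" .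
      show ?thesis unfolding eq by (simp add: algebra_simps add_divide_distrib diff_divide_distrib)
    qed
    ultimately show ?thesis by simp
  qed
qed

text \<open>Rolle's theorem for \<open>t\<^sup>a\<^sup>+\<^sup>1 exp (-2 t) L(t)\<close>, which vanishes at 0 and at infinity; the substitution
  \<open>t = exp s\<close> moves the end point 0 to minus infinity.\<close>

lemma laguerre_roots:
  "-1 < a \<Longrightarrow> \<exists>Z. finite Z \<and> card Z = m \<and> (\<forall>z\<in>Z. 0 < z \<and> poly (laguerre m a) z = 0)"
proof (induction m arbitrary: a)
  case (Suc m)
  define P where "P = laguerre m (a + 1)"
  define g where "g = (\<lambda>t. t * poly (pderiv P) t + (a + 1 - 2 * t) * poly P t)"
  have g: "g t = (a + 1) * poly (laguerre (Suc m) a) t" for t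
    using arg_cong[OF laguerre_raise[OF Suc.prems, of m], of "\<lambda>q. poly q t"]
    by (simp add: g_def P_def algebra_simps)
  obtain Z where Z: "finite Z" "card Z = m" "\<forall>z\<in>Z. 0 < z \<and> poly P z = 0"
    using Suc.IH[of "a + 1"] Suc.prems by (auto simp: P_def)
  have "\<exists>Y. finite Y \<and> card Y = Suc m \<and> (\<forall>y\<in>Y. 0 < y \<and> g y = 0)"
  proof (cases "m = 0")
    \<comment> \<open>Without zeros there is no starting point for Rolle's theorem, but g is linear
      and its root is explicit.\<close>
    case True
    have "P = 1" unfolding P_def laguerre_def True by (simp add: monom_0 one_pCons)
    then have "g ((a + 1) / 2) = 0" by (simp add: g_def)
    then show ?thesis using True Suc.prems by (intro exI[of _ "{(a + 1) / 2}"]) auto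
  next
    case False
    define G where "G = (\<lambda>s. exp ((a + 1) * s) * (exp (- 2 * exp s) * poly P (exp s)))"
    have G': "(G has_real_derivative exp ((a + 1) * s) * exp (- 2 * exp s) * g (exp s)) (at s)" for s
      unfolding G_def g_def
      by (auto intro!: derivative_eq_intros DERIV_chain2[OF poly_DERIV] simp: algebra_simps)
    define S where "S = ln ` Z"
    have inj: "inj_on ln Z" using Z(3) by (auto intro!: inj_onI)
    have S: "finite S" "card S = m" "\<forall>s\<in>S. G s = 0"
      using Z inj by (auto simp: S_def card_image G_def)
    have "S \<noteq> {}" using S(2) False by auto
    have lim: "(G \<longlongrightarrow> 0) at_top"
    proof (rule Lim_null_comparison)
      \<comment> \<open>The factor exp(- 2 exp s) is split in two: one half absorbs exp((a + 1) s),
        since exp s exceeds s^2 / 2, and the other half beats the polynomial.\<close>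
      have "\<bar>G s\<bar> \<le> exp ((a + 1)\<^sup>2 / 2) * \<bar>poly P (exp s) * exp (- exp s)\<bar>" if "0 \<le> s" for s
      proof -
        have "(a + 1) * s - exp s \<le> (a + 1) * s - s\<^sup>2 / 2"
          using exp_lower_Taylor_quadratic[OF that] that by simp
        also have "\<dots> \<le> (a + 1)\<^sup>2 / 2"
          using sum_squares_bound[of "a + 1" s] by (simp add: field_simps)
        finally have "exp ((a + 1) * s - exp s) \<le> exp ((a + 1)\<^sup>2 / 2)" by simp
        moreover have "G s = exp ((a + 1) * s - exp s) * (poly P (exp s) * exp (- exp s))"
        proof -
          have "exp (- 2 * exp s) = exp (- exp s) * exp (- exp s)" by (simp add: exp_add[symmetric])
          then show ?thesis by (simp add: G_def exp_diff exp_minus field_simps)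
        qed
        ultimately show ?thesis by (simp add: abs_mult mult_right_mono)
      qed
      then show "\<forall>\<^sub>F s in at_top. norm (G s) \<le> exp ((a + 1)\<^sup>2 / 2) * \<bar>poly P (exp s) * exp (- exp s)\<bar>"
        by (intro eventually_mono[OF eventually_ge_at_top[of 0]]) simp
      have "((\<lambda>t. poly P t * exp (- t)) \<longlongrightarrow> 0) at_top"
        by (rule exp_space_tendsto_0[OF poly_exp_in_exp_space[of P "Suc (degree P)"]]) auto
      then have "((\<lambda>s. poly P (exp s) * exp (- exp s)) \<longlongrightarrow> 0) at_top"
        by (rule filterlim_compose[OF _ exp_at_top])
      then show "((\<lambda>s. exp ((a + 1)\<^sup>2 / 2) * \<bar>poly P (exp s) * exp (- exp s)\<bar>) \<longlongrightarrow> 0) at_top"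
        by (intro tendsto_mult_right_zero tendsto_rabs_zero)
    qed
    \<comment> \<open>Here a > -1 enters: exp((a + 1) s) vanishes at minus infinity. Mirroring s
      then yields one critical point below the smallest zero, raising the count from m to m +
      1.\<close>
    have lim_bot: "((\<lambda>s. G (- s)) \<longlongrightarrow> 0) at_top"
    proof -
      have u: "filterlim (\<lambda>s::real. - s) at_bot at_top" by (rule filterlim_uminus_at_bot_at_top)
      have e: "((\<lambda>s::real. exp (- s)) \<longlongrightarrow> 0) at_top"
        by (rule filterlim_compose[OF exp_at_bot u])
      have "filterlim (\<lambda>s. (a + 1) * s) at_top at_top" using Suc.prems
        by (intro filterlim_tendsto_pos_mult_at_top[OF tendsto_const]) (auto simp: filterlim_ident)
      then have "((\<lambda>s. exp (- ((a + 1) * s))) \<longlongrightarrow> 0) at_top"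
        by (rule filterlim_compose[OF e])
      moreover have "((\<lambda>s. exp (- 2 * exp (- s)) * poly P (exp (- s)))
          \<longlongrightarrow> exp (- 2 * 0) * poly P 0) at_top"
        by (intro tendsto_intros e)
      ultimately show ?thesis unfolding G_def
        using tendsto_mult by (fastforce simp: algebra_simps)
    qed
    obtain Y where Y: "finite Y" "card Y = card S"
      "\<forall>s\<in>Y. exp ((a + 1) * s) * exp (- 2 * exp s) * g (exp s) = 0" "\<forall>y\<in>Y. \<exists>s\<in>S. s < y"
      using Rolle_at_infinity_finite_set[OF S(1) G' S(3) lim] .
    have "((\<lambda>s. G (- s)) has_real_derivative
        - (exp ((a + 1) * - s) * exp (- 2 * exp (- s)) * g (exp (- s)))) (at s)" for s
      by (rule DERIV_mirror[THEN iffD1, OF G'])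
    from critical_point_after_zero[OF this _ lim_bot, of "- Min S"]
    obtain c where c: "c > - Min S" "- (exp ((a + 1) * - c) * exp (- 2 * exp (- c)) * g (exp (- c))) = 0"
      using S(3) Min_in[OF S(1) \<open>S \<noteq> {}\<close>] by auto
    have "- c \<notin> Y"
    proof
      assume "- c \<in> Y"
      then obtain s where "s \<in> S" "s < - c" using Y(4) by blast
      then show False using c(1) Min_le[OF S(1)] by fastforce
    qed
    moreover have "card (exp ` insert (- c) Y) = card (insert (- c) Y)"
      by (intro card_image inj_onI) simp
    ultimately have "card (exp ` insert (- c) Y) = Suc m" "finite (exp ` insert (- c) Y)"
      using Y S by auto
    moreover have "\<forall>y\<in>exp ` insert (- c) Y. 0 < y \<and> g y = 0"
      using Y(3) c(2) by auto
    ultimately show ?thesis by blast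
  qed
  then show ?case using g Suc.prems by auto
qed (auto intro: exI[of _ "{}"])

text \<open>These are the even Hermite polynomials in \<open>x\<^sup>2 = 2 t\<close>, normalized to 1 at 0.\<close>

abbreviation hermite :: "nat \<Rightarrow> real poly" where
  "hermite n \<equiv> laguerre n (- 1 / 2)"

text \<open>Kummer's equation for the argument 2 t; coefficientwise it is the two-term recursion
  \<open>rec\<close>.\<close>

lemma hermite_ode:
  "t * poly (pderiv (pderiv (hermite n))) t + (1 / 2 - 2 * t) * poly (pderiv (hermite n)) t
     + 2 * real n * poly (hermite n) t = 0"
proof -
  define R where "R = hermite n"
  have rec: "(real i + 1) * (real i + 1 / 2) * coeff R (Suc i) = 2 * (real i - real n) * coeff R i" for i
  proof -
    define P where "P = pochhammer (1 / 2 :: real) i"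
    have nz: "P \<noteq> 0" "1 / 2 + real i \<noteq> 0"
      using pochhammer_pos[of "1 / 2 :: real" i] by (auto simp: P_def)
    have p: "pochhammer (1 / 2 :: real) (Suc i) = P * (1 / 2 + real i)" by (simp add: pochhammer_Suc P_def)
    have "real (Suc i) * real (n choose Suc i) = (real n - real i) * real (n choose i)"
    proof (cases "i \<le> n")
      case True
      have "Suc i * (n choose Suc i) = (n - i) * (n choose i)"
        using binomial_absorb_comp[of n i] binomial_absorption[of i n] by simp
      then have "real (Suc i * (n choose Suc i)) = real ((n - i) * (n choose i))" by simp
      then show ?thesis using True by (simp only: of_nat_mult of_nat_diff)
    qed (simp add: binomial_eq_0)
    then have b: "(real i + 1) * real (n choose Suc i) = (real n - real i) * real (n choose i)"
      by (simp add: add.commute)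
    have "(real i + 1) * (real i + 1 / 2) * coeff R (Suc i)
        = ((real i + 1) * real (n choose Suc i)) * (-2) ^ Suc i / P"
      using nz by (simp add: R_def coeff_laguerre p add.commute)
    also have "\<dots> = 2 * (real i - real n) * coeff R i"
      unfolding b by (simp add: R_def coeff_laguerre P_def algebra_simps diff_divide_distrib)
    finally show ?thesis .
  qed
  have "pCons 0 (pderiv (pderiv R)) + smult (1 / 2) (pderiv R) - smult 2 (pCons 0 (pderiv R))
      + smult (2 * real n) R = 0"
  proof (rule poly_eqI)
    fix i
    show "coeff (pCons 0 (pderiv (pderiv R)) + smult (1 / 2) (pderiv R)
        - smult 2 (pCons 0 (pderiv R)) + smult (2 * real n) R) i = coeff 0 i"
      using rec[of i] by (cases i) (auto simp: coeff_pderiv field_simps)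
  qed
  from arg_cong[OF this, of "\<lambda>q. poly q t"] show ?thesis
    by (simp add: R_def algebra_simps)
qed

section \<open>Sonin's function and the alternation of \<open>hfun\<close>\<close>

lemma poly_exp_DERIV:
  "((\<lambda>t. poly q t * exp (- t)) has_real_derivative poly (pderiv q - q) t * exp (- t)) (at t)"
  by (auto intro!: derivative_eq_intros DERIV_chain2[OF poly_DERIV] simp: algebra_simps)

lemma poly_exp_tendsto_0: "((\<lambda>t. poly q t * exp (- t)) \<longlongrightarrow> 0) at_top" for q :: "real poly"
  by (rule exp_space_tendsto_0[OF poly_exp_in_exp_space[of q "Suc (degree q)"]]) auto

definition hfun :: "nat \<Rightarrow> real \<Rightarrow> real" where
  "hfun n t = poly (hermite n) t * exp (- t)"

definition hfun' :: "nat \<Rightarrow> real \<Rightarrow> real" where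
  "hfun' n t = poly (pderiv (hermite n) - hermite n) t * exp (- t)"

lemma hfun_DERIV: "(hfun n has_real_derivative hfun' n t) (at t)"
  unfolding hfun_def[abs_def] hfun'_def by (rule poly_exp_DERIV)

lemma hfun_0: "hfun n 0 = 1"
  by (simp add: hfun_def poly_laguerre_0)

lemma hfun_tendsto_0: "(hfun n \<longlongrightarrow> 0) at_top"
  unfolding hfun_def[abs_def] by (rule poly_exp_tendsto_0)

lemma hfun_in_exp_space: "hfun n \<in> exp_space (replicate (Suc n) 1)"
  unfolding hfun_def[abs_def] using degree_laguerre[of n "-1/2"]
  by (intro poly_exp_in_exp_space) simp

text \<open>Sonin's function: it decreases because \<open>w = hfun n\<close> satisfies
  \<open>t w'' + w' / 2 + (2 n + 1 / 2 - t) w = 0\<close>, and it controls \<open>w\<close> at its critical points.\<close>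

definition sonin :: "nat \<Rightarrow> real \<Rightarrow> real" where
  "sonin n t = (2 * real n + 1 / 2 - t) * (hfun n t)\<^sup>2 + t * (hfun' n t)\<^sup>2"

lemma sonin_DERIV: "(sonin n has_real_derivative - (hfun n t)\<^sup>2) (at t)"
proof -
  define R where "R = hermite n"
  define w where "w = poly (pderiv (pderiv R - R) - (pderiv R - R)) t * exp (- t)"
  have w: "(hfun' n has_real_derivative w) (at t)"
    unfolding hfun'_def[abs_def] w_def R_def by (rule poly_exp_DERIV)
  have "t * w + hfun' n t / 2 + (2 * real n + 1 / 2 - t) * hfun n t
      = (t * poly (pderiv (pderiv R)) t + (1 / 2 - 2 * t) * poly (pderiv R) t
          + 2 * real n * poly R t) * exp (- t)"
    by (simp add: w_def hfun'_def hfun_def R_def pderiv_diff algebra_simps add_divide_distrib diff_divide_distrib)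
  then have ode: "t * w + hfun' n t / 2 + (2 * real n + 1 / 2 - t) * hfun n t = 0"
    using hermite_ode by (simp add: R_def)
  have eq: "- u\<^sup>2 + X * (2 * u * v) + v\<^sup>2 + t * (2 * v * w) = - u\<^sup>2"
    if "t * w + v / 2 + X * u = 0" for u v X
  proof -
    have "- u\<^sup>2 + X * (2 * u * v) + v\<^sup>2 + t * (2 * v * w) = - u\<^sup>2 + 2 * v * (t * w + v / 2 + X * u)"
      by (simp add: algebra_simps power2_eq_square)
    then show ?thesis using that by simp
  qed
  show ?thesis unfolding sonin_def[abs_def]
    by (rule DERIV_cong, (rule derivative_eq_intros hfun_DERIV w refl)+)
      (use eq[OF ode] in \<open>simp add: algebra_simps\<close>)
qed

lemma sonin_antimono: "s \<le> t \<Longrightarrow> sonin n t \<le> sonin n s"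
  by (rule DERIV_nonpos_imp_nonincreasing[of s t]) (use sonin_DERIV in force)+

lemma sonin_0: "sonin n 0 = 2 * real n + 1 / 2"
  by (simp add: sonin_def hfun_0)

text \<open>A decreasing function stays above its limit, which is 0 by the exponential
  decay.\<close>

lemma sonin_nonneg: "0 \<le> sonin n t"
proof (rule tendsto_upperbound)
  define R where "R = hermite n"
  define Q where "Q = pderiv R - R"
  have "((\<lambda>t. (poly ([:2 * real n + 1 / 2, -1:] * R) t * exp (- t)) * hfun n t
      + (poly ([:0, 1:] * Q) t * exp (- t)) * (poly Q t * exp (- t))) \<longlongrightarrow> 0 * 0 + 0 * 0) at_top"
    by (intro tendsto_intros poly_exp_tendsto_0 hfun_tendsto_0)
  also have "(\<lambda>t. (poly ([:2 * real n + 1 / 2, -1:] * R) t * exp (- t)) * hfun n t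
      + (poly ([:0, 1:] * Q) t * exp (- t)) * (poly Q t * exp (- t))) = sonin n"
    by (auto simp: sonin_def hfun_def hfun'_def R_def Q_def power2_eq_square algebra_simps)
  finally show "(sonin n \<longlongrightarrow> 0) at_top" by simp
  show "\<forall>\<^sub>F x in at_top. sonin n x \<le> sonin n t"
    using eventually_ge_at_top[of t] by eventually_elim (rule sonin_antimono)
qed simp

lemma sonin_pos:
  assumes "hfun n t \<noteq> 0"
  shows "0 < sonin n t"
proof -
  obtain e where "e > 0" "\<And>h. 0 < h \<Longrightarrow> h < e \<Longrightarrow> sonin n (t + h) < sonin n t"
    using DERIV_neg_dec_right[OF sonin_DERIV] assms by force
  then have "sonin n (t + e / 2) < sonin n t" by simp
  then show ?thesis using sonin_nonneg[of n "t + e / 2"] by simp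
qed

text \<open>At a critical point the positive value of \<open>sonin\<close> is (2 n + 1/2 - t) w^2,
  so nontrivial critical points occur only in the oscillatory range.\<close>

lemma hfun_critical_less:
  assumes "hfun' n t = 0" "hfun n t \<noteq> 0"
  shows "t < 2 * real n + 1 / 2"
  using sonin_pos[OF assms(2)] assms by (auto simp: sonin_def zero_less_mult_iff)

text \<open>Dividing by X - t turns the decreasing \<open>sonin\<close> into the increasing w^2 + t
  w'^2 / (X - t), with derivative t w'^2 / (X - t)^2. It starts at 1 and equals w^2 at critical
  points.\<close>

lemma hfun_critical_ge:
  assumes "hfun' n t = 0" "hfun n t \<noteq> 0" "0 \<le> t"
  shows "1 \<le> \<bar>hfun n t\<bar>"
proof -
  define X where "X = 2 * real n + 1 / 2"
  have t: "t < X" using hfun_critical_less[OF assms(1,2)] by (simp add: X_def)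
  have "sonin n 0 / (X - 0) \<le> sonin n t / (X - t)"
  proof (rule DERIV_nonneg_imp_nondecreasing[OF assms(3)])
    fix x assume x: "0 \<le> x" "x \<le> t"
    have "((\<lambda>t. sonin n t / (X - t)) has_real_derivative
      (- (hfun n x)\<^sup>2 * (X - x) - sonin n x * (- 1)) / ((X - x) * (X - x))) (at x)"
      using x t by (auto intro!: derivative_eq_intros sonin_DERIV)
    moreover have "- (hfun n x)\<^sup>2 * (X - x) - sonin n x * (- 1) = x * (hfun' n x)\<^sup>2"
      by (simp add: sonin_def X_def algebra_simps)
    ultimately show "\<exists>y. ((\<lambda>t. sonin n t / (X - t)) has_real_derivative y) (at x) \<and> 0 \<le> y"
      using x by (intro exI[of _ "x * (hfun' n x)\<^sup>2 / ((X - x) * (X - x))"] conjI) auto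
  qed
  moreover have "sonin n t / (X - t) = (hfun n t)\<^sup>2"
    using t assms(1) by (simp add: sonin_def X_def)
  ultimately have "1 \<le> (hfun n t)\<^sup>2" by (simp add: sonin_0 X_def)
  then show ?thesis by (simp add: abs_le_square_iff[of 1, simplified])
qed

text \<open>Without a sign change, f a * f would have a local minimum at z and hence derivative 0
  there.\<close>

lemma sign_change_at_simple_zero:
  fixes f :: "real \<Rightarrow> real"
  assumes f: "\<And>t. (f has_real_derivative f' t) (at t)" and z: "a < z" "z < b" "f z = 0" "f' z \<noteq> 0"
    and nz: "\<And>t. a \<le> t \<Longrightarrow> t \<le> b \<Longrightarrow> t \<noteq> z \<Longrightarrow> f t \<noteq> 0"
  shows "f a * f b < 0"
proof (rule ccontr)
  assume "\<not> ?thesis"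
  then have ab: "0 < f a * f b" using nz[of a] nz[of b] z by (simp add: not_less order_le_less)
  have cont: "continuous_on S f" for S
    by (meson f continuous_at_imp_continuous_on DERIV_isCont)
  have pos: "0 \<le> f a * f t" if "a \<le> t" "t \<le> b" for t
  proof (rule ccontr)
    assume "\<not> ?thesis"
    then have neg: "f a * f t < 0" by simp
    then have "t \<noteq> z" "t \<noteq> a" using z by (auto simp: mult_less_0_iff)
    show False
    proof (cases "t < z")
      case True
      have "a < t" using that \<open>t \<noteq> a\<close> by simp
      then obtain c where "a < c" "c < t" "f c = 0"
        using zero_between[of a t f] neg cont by blast
      then show ?thesis using nz[of c] True z by auto
    next
      case False
      have "f t * f b < 0" using neg ab by (auto simp: mult_less_0_iff zero_less_mult_iff)
      moreover have "t < b" using neg ab that by (cases "t = b") auto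
      ultimately obtain c where "t < c" "c < b" "f c = 0"
        using zero_between[of t b f] cont by blast
      then show ?thesis using nz[of c] False z \<open>t \<noteq> z\<close> by auto
    qed
  qed
  have "f a * f' z = 0"
  proof (rule DERIV_local_min)
    show "((\<lambda>t. f a * f t) has_real_derivative f a * f' z) (at z)" by (intro DERIV_cmult f)
    show "0 < min (z - a) (b - z)" using z by simp
    show "\<forall>y. \<bar>z - y\<bar> < min (z - a) (b - z) \<longrightarrow> f a * f z \<le> f a * f y"
      using pos z by (auto simp: abs_less_iff)
  qed
  then show False using z(4) ab by auto
qed

text \<open>The n + 1 nodes are 0 and one critical point after each of the n zeros, the last from
  the decay at infinity. All zeros are simple, so the signs alternate, and Sonin's argument gives
  the size.\<close>

lemma hfun_alternation:
  obtains \<nu> where "increasing_upto (Suc n) \<nu>" "\<nu> 0 = 0" "\<forall>j<Suc n. 1 \<le> (-1) ^ j * hfun n (\<nu> j)"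
proof -
  obtain Z where Z: "finite Z" "card Z = n" "\<forall>z\<in>Z. 0 < z \<and> poly (hermite n) z = 0"
    using laguerre_roots[of "- 1 / 2" n] by auto
  have Z0: "hfun n z = 0" if "z \<in> Z" for z using Z that by (simp add: hfun_def)
  have nz: "hfun n t \<noteq> 0" if "t \<notin> Z" for t
  proof
    assume "hfun n t = 0"
    then have "hfun n 0 = 0" using Z Z0 that
      by (intro exp_space_zeros[OF hfun_in_exp_space, of "insert t Z"]) auto
    then show False by (simp add: hfun_0)
  qed
  have simple: "hfun' n z \<noteq> 0" if "z \<in> Z" for z
  proof
    assume "hfun' n z = 0"
    then have "deriv (hfun n) z = 0" using DERIV_imp_deriv[OF hfun_DERIV] by simp
    then have "hfun n 0 = 0" using Z Z0 that
      by (intro exp_space_double_zero[OF hfun_in_exp_space, of Z n z]) auto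
    then show False by (simp add: hfun_0)
  qed
  define r where "r = (\<lambda>i. sorted_list_of_set Z ! i)"
  have r_less: "r i < r j" if "i < j" "j < n" for i j
    unfolding r_def using that Z(1,2) sorted_wrt_nth_less[OF strict_sorted_list_of_set[of Z], of i j] by simp
  have r_mem: "r i \<in> Z" if "i < n" for i
    unfolding r_def using that Z(1,2) nth_mem[of i "sorted_list_of_set Z"] by simp
  have r_all: "\<exists>i<n. y = r i" if "y \<in> Z" for y
    unfolding r_def using that Z(1,2) in_set_conv_nth[of y "sorted_list_of_set Z"] by auto
  have r_le: "r i \<le> r j" if "i \<le> j" "j < n" for i j
    using r_less[of i j] that by (cases "i = j") auto
  have "\<exists>y. r j < y \<and> (Suc j < n \<longrightarrow> y < r (Suc j)) \<and> hfun' n y = 0" if "j < n" for j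
  proof (cases "Suc j < n")
    case True
    obtain y where "r j < y" "y < r (Suc j)" "hfun n (r (Suc j)) - hfun n (r j) = (r (Suc j) - r j) * hfun' n y"
      using MVT2[OF r_less[of j "Suc j"] hfun_DERIV] True by blast
    then show ?thesis using Z0 r_mem[OF that] r_mem[OF True] by auto
  next
    case False
    then show ?thesis
      using critical_point_after_zero[OF hfun_DERIV Z0[OF r_mem[OF that]] hfun_tendsto_0] by blast
  qed
  then obtain y where y: "\<And>j. j < n \<Longrightarrow> r j < y j" "\<And>j. Suc j < n \<Longrightarrow> y j < r (Suc j)"
      "\<And>j. j < n \<Longrightarrow> hfun' n (y j) = 0"
    by (metis Suc_lessD)
  define \<nu> where "\<nu> = (\<lambda>j. case j of 0 \<Rightarrow> 0 | Suc i \<Rightarrow> y i)"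
  have lower: "\<nu> j < r i" if "j \<le> i" "i < n" for i j
    using that Z(3) r_mem[of i] y(2)[of "j - 1"] r_le[of j i] by (cases j) (auto simp: \<nu>_def)
  have upper: "r i < \<nu> j" if "i < j" "j \<le> n" for i j
    using that y(1)[of "j - 1"] r_le[of i "j - 1"] by (cases j) (auto simp: \<nu>_def)
  have inc: "increasing_upto (Suc n) \<nu>"
    unfolding increasing_upto_def using lower upper
    by (meson less_Suc_eq_le less_le_trans less_trans order_refl)
  have alt: "0 < (-1) ^ j * hfun n (\<nu> j)" if "j < Suc n" for j
    using that
  proof (induction j)
    case (Suc j)
    have "hfun n (\<nu> j) * hfun n (\<nu> (Suc j)) < 0"
    proof (rule sign_change_at_simple_zero[OF hfun_DERIV])
      show "\<nu> j < r j" "r j < \<nu> (Suc j)" using lower[of j j] upper[of j "Suc j"] Suc.prems by auto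
      show "hfun n (r j) = 0" "hfun' n (r j) \<noteq> 0" using Z0 simple r_mem Suc.prems by auto
      show "hfun n t \<noteq> 0" if t: "\<nu> j \<le> t" "t \<le> \<nu> (Suc j)" "t \<noteq> r j" for t
      proof
        assume "hfun n t = 0"
        then obtain i where i: "i < n" "t = r i" using nz r_all by blast
        then show False
          using t upper[of i j] lower[of "Suc j" i] Suc.prems
          by (cases i j rule: linorder_cases) auto
      qed
    qed
    then show ?case using Suc by (auto simp: zero_less_mult_iff mult_less_0_iff)
  qed (simp add: \<nu>_def hfun_0)
  have "1 \<le> (-1) ^ j * hfun n (\<nu> j)" if "j < Suc n" for j
  proof -
    have "1 \<le> \<bar>hfun n (\<nu> j)\<bar>"
    proof (cases j)
      case (Suc i)
      then have "0 \<le> y i" using y(1)[of i] r_mem[of i] Z(3) that by force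
      then show ?thesis
        using Suc that y(3)[of i] alt[OF that] by (intro hfun_critical_ge) (auto simp: \<nu>_def)
    qed (simp add: \<nu>_def hfun_0)
    also have "\<dots> = \<bar>(-1) ^ j * hfun n (\<nu> j)\<bar>" by (simp add: abs_mult power_abs)
    also have "\<dots> = (-1) ^ j * hfun n (\<nu> j)" using alt[OF that] by simp
    finally show ?thesis .
  qed
  then show ?thesis using that[of \<nu>] inc by (simp add: \<nu>_def)
qed

section \<open>Derivatives at 0 in closed form\<close>

lemma sum_choose_Suc:
  fixes u :: "nat \<Rightarrow> real"
  shows "(\<Sum>j\<le>Suc k. real (Suc k choose j) * u j) = (\<Sum>j\<le>k. real (k choose j) * (u j + u (Suc j)))"
proof -
  have "(\<Sum>j\<le>k. real (k choose j) * u j) = (\<Sum>j\<le>Suc k. real (k choose j) * u j)" by simp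
  also have "\<dots> = u 0 + (\<Sum>j\<le>k. real (k choose Suc j) * u (Suc j))"
    by (subst sum.atMost_Suc_shift) simp
  finally have "u 0 + (\<Sum>j\<le>k. real (k choose Suc j) * u (Suc j)) = (\<Sum>j\<le>k. real (k choose j) * u j)"
    by simp
  then show ?thesis
    by (subst sum.atMost_Suc_shift) (simp add: algebra_simps sum.distrib)
qed

text \<open>Leibniz's rule, obtained by iterating q -> q' - q; the induction step is Pascal's
  rule.\<close>

lemma iter_deriv_poly_exp_at_0:
  "(-1) ^ k * (deriv ^^ k) (\<lambda>t. poly q t * exp (- t)) 0
     = (\<Sum>j\<le>k. real (k choose j) * ((-1) ^ j * fact j * coeff q j))"
proof (induction k arbitrary: q)
  case 0
  show ?case by (simp add: poly_0_coeff_0)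
next
  case (Suc k)
  have "deriv (\<lambda>t. poly q t * exp (- t)) = (\<lambda>t. poly (pderiv q - q) t * exp (- t))"
    using DERIV_imp_deriv[OF poly_exp_DERIV] by blast
  then have "(-1) ^ Suc k * (deriv ^^ Suc k) (\<lambda>t. poly q t * exp (- t)) 0
      = - ((-1) ^ k * (deriv ^^ k) (\<lambda>t. poly (pderiv q - q) t * exp (- t)) 0)"
    by (simp add: funpow_Suc_right del: funpow.simps)
  also have "\<dots> = (\<Sum>j\<le>k. real (k choose j) * ((-1) ^ j * fact j * coeff q j
      + (-1) ^ Suc j * fact (Suc j) * coeff q (Suc j)))"
    unfolding Suc.IH sum_negf[symmetric]
    by (intro sum.cong refl) (simp add: coeff_pderiv algebra_simps)
  also have "\<dots> = (\<Sum>j\<le>Suc k. real (Suc k choose j) * ((-1) ^ j * fact j * coeff q j))"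
    by (rule sum_choose_Suc[symmetric])
  finally show ?case .
qed

text \<open>Only the polynomial factor is dilated, so the exponent remains 1 and the function
  remains in the extremal space.\<close>

definition scaled_hfun :: "nat \<Rightarrow> real \<Rightarrow> real \<Rightarrow> real" where
  "scaled_hfun n c t = poly (pcompose (hermite n) [:0, c:]) t * exp (- t)"

lemma scaled_hfun_in_Pspace: "scaled_hfun n c \<in> Pspace (replicate (Suc n) 1)"
  unfolding scaled_hfun_def[abs_def]
proof (rule poly_exp_in_Pspace)
  have "degree (pcompose (hermite n) [:0, c:]) \<le> n * 1"
    using degree_laguerre[of n "-1/2"]
    by (intro order.trans[OF degree_pcompose_le] mult_le_mono) auto
  then show "degree (pcompose (hermite n) [:0, c:]) < Suc n" by simp
qed

text \<open>The origin of 8^j: a factor 2^j from the coefficients of \<open>hermite\<close> and a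
  factor 4^j from writing the Pochhammer symbol of 1/2 as (2j choose j) j! / 4^j.\<close>

lemma iter_deriv_scaled_hfun_at_0:
  "(-1) ^ k * (deriv ^^ k) (scaled_hfun n c) 0 =
     (\<Sum>j\<le>k. c ^ j * (8 ^ j * real (n choose j) * real (k choose j) / real ((2 * j) choose j)))"
proof -
  have coeff: "(-1) ^ j * fact j * coeff (pcompose (hermite n) [:0, c:]) j
      = c ^ j * (8 ^ j * real (n choose j) / real ((2 * j) choose j))" for j
  proof -
    define P where "P = pochhammer (1 / 2 :: real) j"
    have P: "P \<noteq> 0" using pochhammer_pos[of "1 / 2 :: real" j] by (simp add: P_def)
    have "real ((2 * j) choose j) = fact (2 * j) / (fact j * fact j)"
      by (subst binomial_fact) (auto simp: mult_2)
    also have "\<dots> = 4 ^ j * P / fact j"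
      by (simp add: fact_double P_def power_mult)
    finally have c: "real ((2 * j) choose j) = 4 ^ j * P / fact j" .
    have p8: "(8 :: real) ^ j = 4 ^ j * 2 ^ j" by (simp add: power_mult_distrib[symmetric])
    have m2: "(-1) ^ j * (-2) ^ j = (2 :: real) ^ j" by (simp add: power_mult_distrib[symmetric])
    have "(-1) ^ j * fact j * coeff (pcompose (hermite n) [:0, c:]) j
      = c ^ j * (fact j * real (n choose j) * ((-1) ^ j * (-2) ^ j) / P)"
      by (simp add: coeff_pcompose_linear coeff_laguerre P_def)
    also have "\<dots> = c ^ j * (8 ^ j * real (n choose j) / real ((2 * j) choose j))"
      unfolding c m2 p8 using P by (simp add: field_simps)
    finally show ?thesis .
  qed
  show ?thesis
    unfolding scaled_hfun_def[abs_def] iter_deriv_poly_exp_at_0 coeff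
    by (intro sum.cong refl) (simp add: algebra_simps)
qed

lemma bound_Suc:
  "bound k (Suc n) = (\<Sum>j\<le>k. 8 ^ j * real (n choose j) * real (k choose j) / real ((2 * j) choose j))"
  by (simp add: bound_def atMost_atLeast0)

lemma hfun_eq_scaled: "hfun n = scaled_hfun n 1"
  by (auto simp: hfun_def scaled_hfun_def poly_pcompose)

section \<open>The explicit bound and its sharpness\<close>

lemma Mkd_le_bound: "Mkd k (Suc n) \<le> bound k (Suc n)"
proof -
  obtain \<nu> where \<nu>: "increasing_upto (Suc n) \<nu>" "\<nu> 0 = 0" "\<forall>j<Suc n. 1 \<le> (-1) ^ j * hfun n (\<nu> j)"
    using hfun_alternation .
  have S: "Sd (Suc n) \<in> exp_space (replicate (Suc n) 1)" "supRp (Sd (Suc n)) = 1"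
    using Sd_props[of "Suc n"] Pspace_subset_exp_space by (metis le_add1 plus_1_eq_Suc subsetD)+
  have "\<bar>Sd (Suc n) (\<nu> j)\<bar> \<le> 1" if "j < Suc n" for j
    using le_supRp[OF S(1), of "\<nu> j"] S(2) increasing_upto_le[OF \<nu>(1), of 0 j] \<nu>(2) that by simp
  then have "\<bar>(deriv ^^ k) (Sd (Suc n)) 0\<bar> \<le> \<bar>(deriv ^^ k) (hfun n) 0\<bar>"
    using \<nu>
    by (intro alternation_maximizes_deriv[OF S(1) hfun_in_exp_space, of \<nu> 1])
      (auto simp del: replicate_Suc intro: order.strict_trans2[OF zero_less_one] order.trans)
  also have "\<dots> = \<bar>(-1) ^ k * (deriv ^^ k) (hfun n) 0\<bar>" by (simp add: abs_mult power_abs)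
  also have "\<dots> = bound k (Suc n)"
    unfolding hfun_eq_scaled iter_deriv_scaled_hfun_at_0 bound_Suc by (simp add: sum_nonneg)
  finally show ?thesis by (simp add: Mkd_eq)
qed

section \<open>Growth of \<open>hfun\<close> and the lower bound for the maximum\<close>

lemma hfun_sq_le:
  assumes "0 \<le> s"
  shows "(2 * real n + 1 / 2 - s) * (hfun n s)\<^sup>2 + s * (hfun' n s)\<^sup>2 \<le> 2 * real n + 1 / 2"
  using sonin_antimono[OF assms, of n] by (simp add: sonin_0) (simp add: sonin_def)

text \<open>With X = 2 n + 1/2 and y = s / X, Sonin's inequality gives w^2 at most 1 / (1 - y),
  which for y up to 1/2 is at most 1 + 2 y and so at most exp(2 y).\<close>

lemma hfun_le_exp:
  assumes "0 \<le> s" "s \<le> (2 * real n + 1 / 2) / 2"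
  shows "\<bar>hfun n s\<bar> \<le> exp (s / (2 * real n + 1 / 2))"
proof -
  define X where "X = 2 * real n + 1 / 2"
  define y where "y = s / X"
  have X: "X > 0" by (simp add: X_def)
  have y: "0 \<le> y" "y \<le> 1 / 2" using assms[folded X_def] X by (auto simp: y_def field_simps)
  have "0 \<le> s * (hfun' n s)\<^sup>2" using assms(1) by simp
  then have "(X - s) * (hfun n s)\<^sup>2 \<le> X"
    using hfun_sq_le[OF assms(1), of n] unfolding X_def by linarith
  moreover have "X - s = X * (1 - y)" using X by (simp add: y_def field_simps)
  ultimately have "(1 - y) * (hfun n s)\<^sup>2 \<le> 1" using X by (simp add: mult.assoc)
  then have "(hfun n s)\<^sup>2 \<le> 1 / (1 - y)" using y by (simp add: field_simps)
  also have "\<dots> \<le> 1 + 2 * y"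
  proof -
    have "0 \<le> y * (1 - 2 * y)" using y by simp
    then have "1 \<le> (1 + 2 * y) * (1 - y)" by (simp add: algebra_simps)
    then show ?thesis using y by (simp add: divide_le_eq)
  qed
  also have "\<dots> \<le> exp (2 * y)" by (rule exp_ge_add_one_self)
  also have "\<dots> = (exp y)\<^sup>2" by (simp add: exp_double)
  finally show ?thesis
    using abs_le_square_iff[of "hfun n s" "exp y"] by (simp add: y_def X_def)
qed

lemma hfun_le_linear:
  assumes "(2 * real n + 1 / 2) / 2 \<le> s"
  shows "\<bar>hfun n s\<bar> \<le> 2 + (2 * real n + 1 / 2)"
proof -
  define X where "X = 2 * real n + 1 / 2"
  have X: "X > 0" by (simp add: X_def)
  have half: "\<bar>hfun n (X / 2)\<bar> \<le> 2"
  proof -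
    have "\<bar>hfun n (X / 2)\<bar> \<le> exp (1 / 2)"
      using hfun_le_exp[of "X / 2" n, folded X_def] X by simp
    also have "\<dots> \<le> 2" by (rule exp_half_le2)
    finally show ?thesis .
  qed
  have mid: "\<bar>hfun n t\<bar> \<le> 2 + X" if t: "X / 2 \<le> t" "t \<le> X" for t
  proof (cases "t = X / 2")
    case False
    obtain c where c: "X / 2 < c" "c < t" "hfun n t - hfun n (X / 2) = (t - X / 2) * hfun' n c"
      using MVT2[OF _ hfun_DERIV, of "X / 2" t] False t by force
    have "0 \<le> (X - c) * (hfun n c)\<^sup>2" using c t by simp
    then have "c * (hfun' n c)\<^sup>2 \<le> X"
      using hfun_sq_le[of c n, folded X_def] c X by linarith
    \<comment> \<open>Beyond X / 2 Sonin's inequality bounds w'^2 by 2, rounded up to 4 below; an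
      interval of length at most X / 2 then contributes at most X to |w|.\<close>
    moreover have "X / 2 * (hfun' n c)\<^sup>2 \<le> c * (hfun' n c)\<^sup>2"
      using c by (intro mult_right_mono) auto
    ultimately have "X * (hfun' n c)\<^sup>2 \<le> X * 2" by simp
    then have "(hfun' n c)\<^sup>2 \<le> 2\<^sup>2" using X by simp
    then have "\<bar>hfun' n c\<bar> \<le> 2" using abs_le_square_iff[of "hfun' n c" 2] by simp
    then have "\<bar>(t - X / 2) * hfun' n c\<bar> \<le> X / 2 * 2"
      using t unfolding abs_mult by (intro mult_mono) auto
    then show ?thesis using half c(3) by linarith
  next
    case True
    show ?thesis unfolding True using half X by linarith
  qed
  show ?thesis
  proof (cases "s \<le> X")
    \<comment> \<open>A larger value beyond X would, by decay, give w^2 an interior maximum there, a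
      nontrivial critical point excluded by \<open>hfun_critical_less\<close>.\<close>
    case False
    show ?thesis
    proof (rule ccontr)
      assume "\<not> ?thesis"
      then have gt: "2 + X < \<bar>hfun n s\<bar>" by (simp add: X_def)
      have "\<forall>\<^sub>F t in at_top. \<bar>hfun n t\<bar> < \<bar>hfun n s\<bar> \<and> t > s"
        using tendstoD[OF hfun_tendsto_0, of "\<bar>hfun n s\<bar>"] gt X by (simp add: eventually_conj_iff)
      then obtain b where b: "\<bar>hfun n b\<bar> < \<bar>hfun n s\<bar>" "b > s"
        using eventually_happens by force
      have D: "((\<lambda>t. (hfun n t)\<^sup>2) has_real_derivative 2 * hfun n t * hfun' n t) (at t)" for t
        by (auto intro!: derivative_eq_intros hfun_DERIV)
      have "continuous_on {X..b} (\<lambda>t. (hfun n t)\<^sup>2)"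
        by (intro continuous_at_imp_continuous_on ballI DERIV_isCont[OF D])
      then obtain \<tau> where \<tau>: "\<tau> \<in> {X..b}" "\<forall>t\<in>{X..b}. (hfun n t)\<^sup>2 \<le> (hfun n \<tau>)\<^sup>2"
        using continuous_attains_sup[of "{X..b}" "\<lambda>t. (hfun n t)\<^sup>2"] b False by auto
      have ge: "\<bar>hfun n s\<bar> \<le> \<bar>hfun n \<tau>\<bar>"
        using \<tau>(2)[rule_format, of s] b False by (simp add: abs_le_square_iff)
      have "\<tau> \<noteq> X" using mid[of X] ge gt X by auto
      moreover have "\<tau> \<noteq> b" using b ge by auto
      ultimately have inside: "X < \<tau>" "\<tau> < b" using \<tau>(1) by auto
      have "2 * hfun n \<tau> * hfun' n \<tau> = 0"
      proof (rule DERIV_local_max[OF D])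
        show "0 < min (\<tau> - X) (b - \<tau>)" using inside by simp
        show "\<forall>y. \<bar>\<tau> - y\<bar> < min (\<tau> - X) (b - \<tau>) \<longrightarrow> (hfun n y)\<^sup>2 \<le> (hfun n \<tau>)\<^sup>2"
          using \<tau>(2) by (auto simp: abs_less_iff)
      qed
      moreover have "hfun n \<tau> \<noteq> 0" using ge gt X by auto
      ultimately show False using hfun_critical_less[of n \<tau>] inside by (simp add: X_def)
    qed
  qed (use mid assms in \<open>simp add: X_def\<close>)
qed

lemma hfun_subexponential:
  assumes "0 < e" "e < 1" "16 / e\<^sup>2 \<le> 2 * real n + 1 / 2" "0 \<le> s"
  shows "\<bar>hfun n s\<bar> \<le> exp (e * s)"
proof -
  define X where "X = 2 * real n + 1 / 2"
  have "e\<^sup>2 \<le> 1" "e\<^sup>2 \<le> e" using assms(1,2) by (auto simp: power2_eq_square mult_left_le mult_le_one)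
  have eX: "16 \<le> X * e\<^sup>2" using assms(1,3) by (simp add: X_def field_simps)
  have X: "X > 0" by (simp add: X_def)
  have "X * e\<^sup>2 \<le> X * e" and "X * e\<^sup>2 \<le> X * 1"
    using \<open>e\<^sup>2 \<le> 1\<close> \<open>e\<^sup>2 \<le> e\<close> X by (auto intro!: mult_left_mono)
  then have Xe: "1 \<le> X * e" "2 \<le> X" using eX by linarith+
  show ?thesis
  proof (cases "s \<le> X / 2")
    case True
    have "\<bar>hfun n s\<bar> \<le> exp (s / X)" using hfun_le_exp[OF assms(4)] True by (simp add: X_def)
    also have "s / X \<le> e * s" using Xe X assms(4) mult_right_mono[of 1 "X * e" s] by (simp add: field_simps)
    finally show ?thesis by simp
  next
    case False
    define y where "y = e * X / 2"
    have "0 \<le> y" using assms(1) X by (simp add: y_def)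
    have "\<bar>hfun n s\<bar> \<le> 2 + X" using hfun_le_linear[of n s] False by (simp add: X_def)
    also have "\<dots> \<le> 2 * X" using Xe by simp
    \<comment> \<open>The constant 16 comes from here: 2 X is at most (e X / 2)^2 / 2 exactly when
      16 is at most X e^2.\<close>
    also have "\<dots> \<le> y\<^sup>2 / 2"
      using mult_right_mono[OF eX, of X] X by (simp add: y_def power2_eq_square algebra_simps)
    also have "\<dots> \<le> exp y" using exp_lower_Taylor_quadratic[OF \<open>0 \<le> y\<close>] \<open>0 \<le> y\<close> by linarith
    also have "y \<le> e * s" using False assms(1) by (simp add: y_def field_simps)
    finally show ?thesis by simp
  qed
qed

lemma Mkd_ge:
  assumes "0 < c" "c < 1" "16 / (1 - c)\<^sup>2 \<le> 2 * real n + 1 / 2"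
  shows "c ^ k * bound k (Suc n) \<le> Mkd k (Suc n)"
proof -
  have "\<bar>scaled_hfun n c t\<bar> \<le> 1" if "0 \<le> t" for t
  proof -
    \<comment> \<open>Undilated, the exponential leaves a spare factor exp(- (1 - c) t), which
      outweighs the growth exp((1 - c) c t) permitted with e = 1 - c.\<close>
    have "scaled_hfun n c t = hfun n (c * t) * exp (- ((1 - c) * t))"
      by (simp add: scaled_hfun_def hfun_def poly_pcompose exp_add[symmetric] algebra_simps)
    then have "\<bar>scaled_hfun n c t\<bar> \<le> exp ((1 - c) * (c * t)) * exp (- ((1 - c) * t))"
      using hfun_subexponential[of "1 - c" n "c * t"] assms that by (simp add: abs_mult)
    also have "\<dots> = exp ((1 - c) * t * (c - 1))" by (simp add: exp_add[symmetric] algebra_simps)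
    also have "\<dots> \<le> 1" using assms that by (simp add: mult_nonneg_nonpos)
    finally show ?thesis .
  qed
  then have sup: "supRp (scaled_hfun n c) \<le> 1" by (rule supRp_le)
  \<comment> \<open>The j-th term loses only c^j, and c^j is at least c^k for j up to k.\<close>
  have "c ^ k * bound k (Suc n)
      \<le> (\<Sum>j\<le>k. c ^ j * (8 ^ j * real (n choose j) * real (k choose j) / real ((2 * j) choose j)))"
    unfolding bound_Suc sum_distrib_left
    using assms by (intro sum_mono mult_right_mono power_decreasing) auto
  also have "\<dots> = (-1) ^ k * (deriv ^^ k) (scaled_hfun n c) 0"
    by (rule iter_deriv_scaled_hfun_at_0[symmetric])
  also have "\<dots> \<le> \<bar>(-1) ^ k * (deriv ^^ k) (scaled_hfun n c) 0\<bar>" by simp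
  also have "\<dots> = \<bar>(deriv ^^ k) (scaled_hfun n c) 0\<bar>" by (simp add: abs_mult power_abs)
  also have "\<dots> \<le> \<bar>(deriv ^^ k) (Sd (Suc n)) 0\<bar>"
    by (rule iter_deriv_le_Sd_at_0[OF _ _ scaled_hfun_in_Pspace sup]) (auto simp: Delta_def)
  finally show ?thesis by (simp add: Mkd_eq)
qed

lemma bound_pos: "0 < bound k d"
  unfolding bound_def by (rule sum_pos2[of _ 0]) auto

text \<open>For each c < 1 the ratio lies between c^k and 1 once n is large, and c^k is as close to
  1 as desired because k is fixed.\<close>

lemma Mkd_bound_ratio: "(\<lambda>n. Mkd k n / bound k n) \<longlonglongrightarrow> 1"
proof -
  have "(\<lambda>n. Mkd k (Suc n) / bound k (Suc n)) \<longlonglongrightarrow> 1"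
  proof (rule order_tendstoI)
    fix a :: real assume "a < 1"
    have "((\<lambda>c::real. c ^ k) \<longlongrightarrow> 1 ^ k) (at_left 1)" by (intro tendsto_intros)
    then have "\<forall>\<^sub>F c in at_left 1. a < c ^ k" using \<open>a < 1\<close> by (intro order_tendstoD) auto
    moreover have "\<forall>\<^sub>F c in at_left (1::real). 0 < c \<and> c < 1"
      using eventually_at_left_field[of "\<lambda>c. 0 < c \<and> c < 1" 1] zero_less_one by blast
    ultimately have "\<forall>\<^sub>F c in at_left 1. a < c ^ k \<and> 0 < c \<and> c < 1" by eventually_elim auto
    then obtain c where c: "a < c ^ k" "0 < c" "c < 1"
      using eventually_happens'[of "at_left (1::real)"] by auto
    obtain N where N: "16 / (1 - c)\<^sup>2 \<le> real N" using real_arch_simple by blast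
    have "a < Mkd k (Suc n) / bound k (Suc n)" if "N \<le> n" for n
    proof -
      have "real N \<le> real n" using that by simp
      then have "c ^ k * bound k (Suc n) \<le> Mkd k (Suc n)" using N c by (intro Mkd_ge) auto
      then have "c ^ k \<le> Mkd k (Suc n) / bound k (Suc n)" using bound_pos by (simp add: le_divide_eq)
      then show ?thesis using c(1) by simp
    qed
    then show "\<forall>\<^sub>F n in sequentially. a < Mkd k (Suc n) / bound k (Suc n)"
      by (rule eventually_sequentiallyI)
  next
    fix a :: real assume "1 < a"
    have "Mkd k (Suc n) / bound k (Suc n) \<le> 1" for n
      using Mkd_le_bound bound_pos by (simp add: divide_le_eq)
    then show "\<forall>\<^sub>F n in sequentially. Mkd k (Suc n) / bound k (Suc n) < a"
      using \<open>1 < a\<close> by (intro always_eventually allI) (rule le_less_trans)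
  qed
  then show ?thesis by (rule LIMSEQ_imp_Suc)
qed

theorem theorem2:
  fixes k d :: nat
  assumes "1 \<le> k" and "1 \<le> d"
  shows "(\<forall>h\<in>Delta d. \<forall>p\<in>Pspace h. supRp p \<le> 1 \<longrightarrow>
            supRp ((deriv ^^ k) p) \<le> supRp ((deriv ^^ k) (Sd d)))
     \<and> Sd d \<in> Pspace (replicate d 1) \<and> supRp (Sd d) \<le> 1
     \<and> Mkd k d = supRp ((deriv ^^ k) (Sd d))
     \<and> Mkd k d \<le> bound k d
     \<and> (\<lambda>n. Mkd k n / bound k n) \<longlonglongrightarrow> 1"
proof (intro conjI ballI impI)
  show "supRp ((deriv ^^ k) p) \<le> supRp ((deriv ^^ k) (Sd d))"
    if "h \<in> Delta d" "p \<in> Pspace h" "supRp p \<le> 1" for h p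
    by (rule supRp_iter_deriv_le_Sd[OF assms(2) that])
  show "Sd d \<in> Pspace (replicate d 1)" "supRp (Sd d) \<le> 1"
    using Sd_props[OF assms(2)] by (metis order_refl)+
  show "Mkd k d = supRp ((deriv ^^ k) (Sd d))"
    by (simp add: Mkd_eq[OF assms(2)] supRp_iter_deriv_Sd[OF assms(2)])
  show "Mkd k d \<le> bound k d"
    using Mkd_le_bound[of k "d - 1"] assms(2) by simp
  show "(\<lambda>n. Mkd k n / bound k n) \<longlonglongrightarrow> 1" by (rule Mkd_bound_ratio)
qed

end
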